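(* Let $\{\psi_j\}_{j=1}^\infty$ and $\{\phi_j\}_{j=1}^\infty$ be frames for $\mathcal{H}$, where $\{\psi_j\}$ has frame bounds $A,B>0$. Suppose there are $c_1>0$ and $s>\frac12$ with $|\langle\psi_j,\phi_l\rangle|\le c_1(1+|j-l|)^{-s}$ for all $j,l\in\mathbb{N}$. For each $n\in\mathbb{N}$ let $$m=m(n)=n+\left\lceil\left[\frac{2c_1^2\,n}{A(2s-1)\lambda_{\min}(\Phi_n)}\right]^{\frac{1}{2s-1}}\right\rceil .$$ Then $W_n$ is invertible on $\mathcal{G}_n$ and $\|W_n^{-1}\|\le \frac{2}{A}$ for all $n\in\mathbb{N}$. Furthermore, if in addition there are $c_0>0$ and $t>1$, $t\ge s$, with $|\langle\phi_j,\phi_l\rangle|\le c_0(1+|j-l|)^{-t}$ for all $j,l\in\mathbb{N}$, and $f\in\mathcal{H}$ satisfies $|\langle f,\phi_j\rangle|\le c'j^{-t}$ for all $j\in\mathbb{N}$ and some $c'>0$, then there exists a constant $c>0$, independent of $n$, such that for all $n\in\mathbb{N}$ $$\|f-f_{n,m}\|\le c\,n^{-(t-1/2)}.$$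
   Context: $\mathcal{H}$ is a separable Hilbert space. A sequence $\{\psi_j\}_{j=1}^\infty\subset\mathcal H$ is a frame with bounds $A,B>0$ if $A\|f\|^2\le\sum_{j=1}^\infty|\langle f,\psi_j\rangle|^2\le B\|f\|^2$ for all $f\in\mathcal{H}$. For $n\in\mathbb{N}$, $\mathcal{G}_n=\mathrm{span}\{\phi_j:1\le j\le n\}$, $Q_n$ is the orthogonal projection of $\mathcal{H}$ onto $\mathcal{G}_n$, $S_mf=\sum_{j=1}^m\langle f,\psi_j\rangle\psi_j$, and $W_n=Q_nS_m|_{\mathcal{G}_n}:\mathcal{G}_n\to\mathcal{G}_n$. The reconstruction of $f$ from $\{\langle f,\psi_j\rangle\}_{j=1}^m$ is $f_{n,m}=\sum_{j=1}^m\langle f,\psi_j\rangle W_n^{-1}Q_n\psi_j=W_n^{-1}Q_nS_mf$. $\Phi_n=[\langle\phi_j,\phi_l\rangle]_{j,l=1}^n$ and $\lambda_{\min}(\Phi_n)$ is its smallest eigenvalue; it is assumed that $\Phi_n$ is invertible for every $n$. *)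

theory Defs
  imports "HOL-Analysis.Analysis" "Jordan_Normal_Form.Char_Poly"
begin

(* Scalars of a Hilbert space.  By Gelfand-Mazur, R and C (with the usual conjugation) are the
   only instances up to isomorphism, so a theorem over this class covers real and complex
   Hilbert spaces at once. *)
class hilbert_scalar = real_normed_field + heine_borel +
  fixes sconj :: "'a \<Rightarrow> 'a"
  assumes sconj_add: "sconj (a + b) = sconj a + sconj b"
    and sconj_mult: "sconj (a * b) = sconj a * sconj b"
    and sconj_scaleR: "sconj (r *\<^sub>R a) = r *\<^sub>R sconj a"
    and sconj_sconj: "sconj (sconj a) = a"
    and mult_sconj: "a * sconj a = (norm a)\<^sup>2 *\<^sub>R 1"

instantiation real :: hilbert_scalar
begin
definition sconj_real :: "real \<Rightarrow> real" where "sconj_real x = x"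
instance by standard (simp_all add: sconj_real_def power2_eq_square)
end

instantiation complex :: hilbert_scalar
begin
definition sconj_complex :: "complex \<Rightarrow> complex" where "sconj_complex = cnj"
instance
proof
  show "a * sconj a = (norm a)\<^sup>2 *\<^sub>R 1" for a :: complex
    unfolding sconj_complex_def by (simp add: scaleR_conv_of_real flip: complex_norm_square)
qed (simp_all add: sconj_complex_def)
end

(* The inner product is linear in its first argument; completeness is the class banach. *)
locale separable_hilbert_space = vector_space smul
  for smul :: "'k::hilbert_scalar \<Rightarrow> 'h::banach \<Rightarrow> 'h" +
  fixes ip :: "'h \<Rightarrow> 'h \<Rightarrow> 'k"
  assumes scaleR_eq_scale: "r *\<^sub>R x = smul (of_real r) x"
    and ip_add_left: "ip (x + y) z = ip x z + ip y z"
    and ip_scale_left: "ip (smul a x) y = a * ip x y"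
    and ip_commute: "ip x y = sconj (ip y x)"
    and ip_self: "ip x x = of_real ((norm x)\<^sup>2)"
    and separable: "\<exists>D :: 'h set. countable D \<and> closure D = UNIV"

(* All sequences are indexed by j = 1, 2, ...; their value at 0 is never used. *)
definition is_frame :: "('h::real_normed_vector \<Rightarrow> 'h \<Rightarrow> 'k::real_normed_field)
    \<Rightarrow> (nat \<Rightarrow> 'h) \<Rightarrow> real \<Rightarrow> real \<Rightarrow> bool" where
  "is_frame ip \<psi> A B \<longleftrightarrow> A > 0 \<and> B > 0 \<and>
     (\<forall>f. (\<lambda>j. (norm (ip f (\<psi> j)))\<^sup>2) summable_on {1..} \<and>
          A * (norm f)\<^sup>2 \<le> (\<Sum>\<^sub>\<infinity>j\<in>{1..}. (norm (ip f (\<psi> j)))\<^sup>2) \<and>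
          (\<Sum>\<^sub>\<infinity>j\<in>{1..}. (norm (ip f (\<psi> j)))\<^sup>2) \<le> B * (norm f)\<^sup>2)"

definition orth_proj :: "('h::ab_group_add \<Rightarrow> 'h \<Rightarrow> 'k::zero) \<Rightarrow> 'h set \<Rightarrow> 'h \<Rightarrow> 'h" where
  "orth_proj ip V f = (THE g. g \<in> V \<and> (\<forall>h\<in>V. ip (f - g) h = 0))"

(* Extended-real valued, so that an unbounded operator has norm infinity. *)
definition op_norm_on :: "'h::real_normed_vector set \<Rightarrow> ('h \<Rightarrow> 'h) \<Rightarrow> ereal" where
  "op_norm_on V T = (SUP x\<in>V. ereal (norm (T x) / norm x))"

definition rec_space :: "('k::comm_ring_1 \<Rightarrow> 'h::ab_group_add \<Rightarrow> 'h) \<Rightarrow> (nat \<Rightarrow> 'h) \<Rightarrow> nat \<Rightarrow> 'h set" where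
  "rec_space smul \<phi> n = module.span smul (\<phi> ` {1..n})"

definition partial_frame_op :: "('k \<Rightarrow> 'h::ab_group_add \<Rightarrow> 'h) \<Rightarrow> ('h \<Rightarrow> 'h \<Rightarrow> 'k)
    \<Rightarrow> (nat \<Rightarrow> 'h) \<Rightarrow> nat \<Rightarrow> 'h \<Rightarrow> 'h" where
  "partial_frame_op smul ip \<psi> m f = (\<Sum>j=1..m. smul (ip f (\<psi> j)) (\<psi> j))"

(* W_n; it depends on m, and only its restriction to rec_space smul \<phi> n is meaningful. *)
definition W_op :: "('k::comm_ring_1 \<Rightarrow> 'h::ab_group_add \<Rightarrow> 'h) \<Rightarrow> ('h \<Rightarrow> 'h \<Rightarrow> 'k)
    \<Rightarrow> (nat \<Rightarrow> 'h) \<Rightarrow> (nat \<Rightarrow> 'h) \<Rightarrow> nat \<Rightarrow> nat \<Rightarrow> 'h \<Rightarrow> 'h" where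
  "W_op smul ip \<psi> \<phi> n m g =
     orth_proj ip (rec_space smul \<phi> n) (partial_frame_op smul ip \<psi> m g)"

definition W_inv :: "('k::comm_ring_1 \<Rightarrow> 'h::ab_group_add \<Rightarrow> 'h) \<Rightarrow> ('h \<Rightarrow> 'h \<Rightarrow> 'k)
    \<Rightarrow> (nat \<Rightarrow> 'h) \<Rightarrow> (nat \<Rightarrow> 'h) \<Rightarrow> nat \<Rightarrow> nat \<Rightarrow> 'h \<Rightarrow> 'h" where
  "W_inv smul ip \<psi> \<phi> n m = inv_into (rec_space smul \<phi> n) (W_op smul ip \<psi> \<phi> n m)"

definition reconstruction :: "('k::comm_ring_1 \<Rightarrow> 'h::ab_group_add \<Rightarrow> 'h) \<Rightarrow> ('h \<Rightarrow> 'h \<Rightarrow> 'k)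
    \<Rightarrow> (nat \<Rightarrow> 'h) \<Rightarrow> (nat \<Rightarrow> 'h) \<Rightarrow> nat \<Rightarrow> nat \<Rightarrow> 'h \<Rightarrow> 'h" where
  "reconstruction smul ip \<psi> \<phi> n m f =
     (\<Sum>j=1..m. smul (ip f (\<psi> j))
        (W_inv smul ip \<psi> \<phi> n m (orth_proj ip (rec_space smul \<phi> n) (\<psi> j))))"

(* Matrix indices start at 0, hence the shift. *)
definition gram_mat :: "('h \<Rightarrow> 'h \<Rightarrow> 'k) \<Rightarrow> (nat \<Rightarrow> 'h) \<Rightarrow> nat \<Rightarrow> 'k mat" where
  "gram_mat ip \<phi> n = mat n n (\<lambda>(j, l). ip (\<phi> (Suc j)) (\<phi> (Suc l)))"

(* Intended for Hermitian matrices of positive dimension, whose eigenvalues are all real. *)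
definition lambda_min :: "'k::{comm_ring_1, real_algebra_1} mat \<Rightarrow> real" where
  "lambda_min M = Min {r::real. eigenvalue M (of_real r)}"

end

theory Submission
  imports Defs
begin

text \<open>The theorem has two halves, one about the inverse of \<open>W\<close> and one about the quality of the
reconstruction; \<open>\<psi>\<close> is the sampling frame and \<open>\<phi>\<close> spans the reconstruction spaces.

Invertibility.  For g in the span of the first n vectors \<open>\<phi>\<close>, \<open>\<langle>W g, g\<rangle>\<close> is the sum of
\<open>|\<langle>g, \<psi>\<^sub>j\<rangle>|\<^sup>2\<close> over \<open>j \<le> m\<close>.  Writing g as a linear combination of the \<open>\<phi>\<^sub>l\<close>, the absolute
squares of the coefficients add up to at most \<open>\<parallel>g\<parallel>\<^sup>2\<close> divided by the smallest eigenvalue of the Gram matrix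
(\<open>lambda_min_gram\<close>), and the off-diagonal decay of \<open>\<langle>\<psi>\<^sub>j, \<phi>\<^sub>l\<rangle>\<close> then makes the part of the frame
sum beyond m at most \<open>A/2 * \<parallel>g\<parallel>\<^sup>2\<close>: this is what the formula for m is made for
(\<open>truncated_coercivity\<close>).  Hence \<open>\<langle>W g, g\<rangle> \<ge> A/2 * \<parallel>g\<parallel>\<^sup>2\<close>, so \<open>W\<close> is injective on a finite-dimensional
space, thus bijective, with inverse bounded by \<open>2/A\<close>.  The same bound shows that the
reconstruction is quasi-optimal: its error is at most a constant times the distance of f from the
reconstruction space (\<open>reconstruction_error_le\<close>).

Rate.  It remains to bound that distance by a multiple of \<open>n powr -(t - 1/2)\<close>.  Let S be the frame
operator of \<open>\<phi>\<close> and \<open>S g = f\<close>.  Then f is the series with coefficients \<open>\<langle>g, \<phi>\<^sub>j\<rangle>\<close>, and if these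
are \<open>O(j powr -t)\<close>, then Bessel's inequality, applied to the part of the series beyond n, gives
the rate (\<open>projection_error_decay\<close>).  So the heart of the matter is that the coefficients of
\<open>S\<^sup>-\<^sup>1 f\<close> decay as fast as those of f (\<open>coefficient_decay_inverse\<close>).  This is a form of Jaffard's
theorem, that matrices with polynomial off-diagonal decay keep it under inversion, for the
pseudo-inverse of the Gram matrix G, which is singular in general.

The argument for it is as follows.  Scale S to K so that \<open>I - K\<close> is a contraction of \<open>\<H>\<close>, with
rate \<open>r < 1\<close>, and scale G to M likewise.  The matrix \<open>R = I - M\<close> is bounded on
square-summable sequences by 1, but in general no better, because M may have a kernel.  Matrices with entries bounded by
\<open>a * (1 + |j - l|) powr -t\<close> form an algebra in which, by splitting a row into a near and a far part,
the row sums are interpolated between the decay constant a and the bound on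
square-summable sequences (\<open>row_sum_interpolation\<close>).  This makes the decay constant of the square of a matrix at most of order
\<open>a powr (1 + \<theta>)\<close> with \<open>\<theta> < 1\<close> (Brandenburg's trick), instead of \<open>a\<^sup>2\<close>; hence the
decay constants of the powers \<open>R\<^sup>k\<close> grow slower than any exponential (\<open>off_diag_decay_L\<close>).
On the other hand \<open>M R\<^sup>k\<close> has norm at most \<open>r\<^sup>k\<close> on square-summable
sequences, since M annihilates its kernel.
Interpolating once more, its row sums decrease geometrically, and
\<open>M\<^sup>2 R\<^sup>2\<^sup>k = (M R\<^sup>k)\<^sup>2\<close> shows that the decay constants of \<open>M\<^sup>2 R\<^sup>k\<close> do, too (\<open>off_diag_decay_K_T\<close>).
Therefore the coefficients of \<open>K\<^sup>2 (I - K)\<^sup>k f\<close> are \<open>O(\<rho>\<^sup>k * j powr -t)\<close> for some \<open>\<rho> < 1\<close>, and the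
factors K are removed one at a time by summing over k (\<open>geometric_ip_descent\<close>).

All the matrices that occur are of the form \<open>\<langle>U \<phi>\<^sub>l, \<phi>\<^sub>j\<rangle>\<close> with U a polynomial in K, up to adding the
identity, so that the computation can be carried out with operators on \<open>\<H>\<close> in place of infinite
matrices: products of matrices correspond to \<open>U K V\<close>.\<close>

section \<open>Conjugation and the inner product\<close>

lemma sconj_zero [simp]: "sconj (0::'a::hilbert_scalar) = 0"
  using sconj_scaleR[of 0 "0::'a"] by simp

lemma sconj_one [simp]: "sconj (1::'a::hilbert_scalar) = 1"
  using mult_sconj[of "1::'a"] by simp

lemma sconj_of_real [simp]: "sconj (of_real r :: 'a::hilbert_scalar) = of_real r"
  by (simp add: of_real_def sconj_scaleR)

lemma sconj_minus: "sconj (- a :: 'a::hilbert_scalar) = - sconj a"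
  using sconj_scaleR[of "-1" a] by simp

lemma sconj_diff: "sconj (a - b :: 'a::hilbert_scalar) = sconj a - sconj b"
  using sconj_add[of a "-b"] by (simp add: sconj_minus)

lemma sconj_sum: "sconj (sum f I :: 'a::hilbert_scalar) = (\<Sum>i\<in>I. sconj (f i))"
  by (induction I rule: infinite_finite_induct) (auto simp: sconj_add)

lemma mult_sconj_eq: "a * sconj a = (of_real ((norm a)\<^sup>2) :: 'a::hilbert_scalar)"
  by (simp add: mult_sconj of_real_def)

lemma norm_sconj [simp]: "norm (sconj a :: 'a::hilbert_scalar) = norm a"
proof -
  have "(of_real ((norm (sconj a))\<^sup>2) :: 'a) = of_real ((norm a)\<^sup>2)"
    by (metis mult.commute mult_sconj_eq sconj_sconj)
  then have "(norm (sconj a))\<^sup>2 = (norm a)\<^sup>2"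
    by (simp only: of_real_eq_iff)
  then show ?thesis by simp
qed

context separable_hilbert_space
begin

lemma ip_add_right: "ip x (y + z) = ip x y + ip x z"
  by (metis ip_add_left ip_commute sconj_add)

lemma ip_scale_right: "ip x (smul a y) = sconj a * ip x y"
  by (metis ip_scale_left ip_commute sconj_mult)

lemma ip_zero_left [simp]: "ip 0 y = 0"
  using ip_add_left[of 0 0 y] by simp

lemma ip_zero_right [simp]: "ip y 0 = 0"
  using ip_add_right[of y 0 0] by simp

lemma ip_minus_left: "ip (- x) y = - ip x y"
  using ip_add_left[of x "-x" y] by (simp add: eq_neg_iff_add_eq_0 add.commute)

lemma ip_diff_left: "ip (x - y) z = ip x z - ip y z"
  using ip_add_left[of x "-y" z] by (simp add: ip_minus_left)

lemma ip_diff_right: "ip z (x - y) = ip z x - ip z y"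
  by (metis ip_diff_left ip_commute sconj_diff)

lemma ip_sum_left: "ip (sum f I) y = (\<Sum>i\<in>I. ip (f i) y)"
  by (induction I rule: infinite_finite_induct) (auto simp: ip_add_left)

lemma ip_sum_right: "ip y (sum f I) = (\<Sum>i\<in>I. ip y (f i))"
  by (induction I rule: infinite_finite_induct) (auto simp: ip_add_right)

lemma ip_scaleR_left: "ip (r *\<^sub>R x) y = of_real r * ip x y"
  by (simp add: scaleR_eq_scale ip_scale_left)

lemma ip_scaleR_right: "ip x (r *\<^sub>R y) = of_real r * ip x y"
  by (simp add: scaleR_eq_scale ip_scale_right)

lemma norm_ip_commute: "norm (ip x y) = norm (ip y x)"
  by (metis ip_commute norm_sconj)

lemma norm_sq_eq_of_ip: "ip x x = of_real r \<Longrightarrow> (norm x)\<^sup>2 = r"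
  using ip_self[of x] of_real_eq_iff by metis

lemma norm_smul: "norm (smul a x) = norm a * norm x"
proof -
  have "ip (smul a x) (smul a x) = (a * sconj a) * ip x x"
    by (simp add: ip_scale_left ip_scale_right mult.assoc)
  also have "\<dots> = of_real ((norm a * norm x)\<^sup>2)"
    by (simp add: mult_sconj_eq ip_self power_mult_distrib)
  finally have "(norm (smul a x))\<^sup>2 = (norm a * norm x)\<^sup>2"
    by (rule norm_sq_eq_of_ip)
  then show ?thesis by (simp add: power2_eq_iff_nonneg)
qed

lemma pythagoras: "ip x y = 0 \<Longrightarrow> (norm (x + y))\<^sup>2 = (norm x)\<^sup>2 + (norm y)\<^sup>2"
proof (rule norm_sq_eq_of_ip)
  assume xy: "ip x y = 0"
  then have "ip y x = 0" using ip_commute[of y x] by simp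
  then have "ip (x + y) (x + y) = ip x x + ip y y"
    unfolding ip_add_left ip_add_right by (simp add: xy)
  then show "ip (x + y) (x + y) = of_real ((norm x)\<^sup>2 + (norm y)\<^sup>2)"
    by (simp only: ip_self of_real_add)
qed

lemma norm_ip_le_cauchy_schwarz: "norm (ip x y) \<le> norm x * norm y"
proof (cases "y = 0")
  case False
  define c where "c = ip x y / of_real ((norm y)\<^sup>2)"
  have "ip (x - smul c y) y = 0"
    using False by (simp add: ip_diff_left ip_scale_left ip_self c_def)
  then have "ip (x - smul c y) (smul c y) = 0"
    by (simp add: ip_scale_right)
  from pythagoras[OF this] have "(norm (smul c y))\<^sup>2 \<le> (norm x)\<^sup>2"
    by simp
  then have "norm c * norm y \<le> norm x"
    unfolding norm_smul by (rule power2_le_imp_le) simp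
  then have "norm c * norm y * norm y \<le> norm x * norm y"
    by (simp add: mult_right_mono)
  moreover have "norm c * norm y * norm y = norm (ip x y)"
    using False by (simp add: c_def norm_divide norm_mult power2_eq_square)
  ultimately show ?thesis by simp
qed simp

text \<open>Identities between vectors, and between values of self-adjoint operators, are proved by testing
against all vectors.\<close>
lemma eq_if_ip_eq: "(\<And>v. ip x v = ip y v) \<Longrightarrow> x = y"
  using ip_self[of "x - y"] by (simp add: ip_diff_left)

lemma tendsto_ip_left: "X \<longlonglongrightarrow> x \<Longrightarrow> (\<lambda>n. ip (X n) v) \<longlonglongrightarrow> ip x v"
proof (rule LIM_zero_cancel, rule Lim_null_comparison)
  assume X: "X \<longlonglongrightarrow> x"
  show "\<forall>\<^sub>F n in sequentially. norm (ip (X n) v - ip x v) \<le> norm (X n - x) * norm v"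
    by (simp add: norm_ip_le_cauchy_schwarz flip: ip_diff_left)
  show "(\<lambda>n. norm (X n - x) * norm v) \<longlonglongrightarrow> 0"
    using tendsto_mult_left_zero[OF tendsto_norm_zero[OF LIM_zero[OF X]]] .
qed

section \<open>Orthogonal projection onto a finite-dimensional subspace\<close>

definition is_proj :: "'h set \<Rightarrow> 'h \<Rightarrow> 'h \<Rightarrow> bool" where
  "is_proj V f g \<longleftrightarrow> g \<in> V \<and> (\<forall>h\<in>V. ip (f - g) h = 0)"

lemma is_proj_unique:
  assumes "subspace V" "is_proj V f g" "is_proj V f g'"
  shows "g = g'"
proof -
  have "g - g' \<in> V" using assms by (auto simp: is_proj_def subspace_diff)
  then have "ip (f - g) (g - g') = 0" "ip (f - g') (g - g') = 0"
    using assms by (auto simp: is_proj_def)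
  then have "ip (g - g') (g - g') = 0"
    by (simp add: ip_diff_left)
  then show ?thesis by (simp add: ip_self)
qed

text \<open>Gram-Schmidt: the new vector a contributes its component e orthogonal to the span of the previous
ones.  If e vanishes, then so does the coefficient c, because division by zero yields zero.\<close>
lemma ex_is_proj:
  assumes "finite S"
  shows "\<exists>g. is_proj (span S) f g"
  using assms
proof (induction S arbitrary: f)
  case empty
  then show ?case by (auto simp: is_proj_def)
next
  case (insert a S)
  obtain b where b: "is_proj (span S) a b" using insert.IH by blast
  define e where "e = a - b"
  have eS: "ip v e = 0" if "v \<in> span S" for v
    using b that ip_commute[of v e] by (simp add: is_proj_def e_def)
  obtain g where g: "is_proj (span S) f g" using insert.IH by blast
  define c where "c = ip f e / ip e e"
  define h where "h = g + smul c e"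
  have b_in: "b \<in> span S" and g_in: "g \<in> span S" using b g by (auto simp: is_proj_def)
  have e_in: "e \<in> span (insert a S)"
    unfolding e_def using b_in span_mono[of S "insert a S"]
    by (intro span_diff) (auto intro: span_base)
  have hS: "ip (f - h) v = 0" if "v \<in> span S" for v
  proof -
    have "ip e v = 0" "ip (f - g) v = 0"
      using that b g by (auto simp: is_proj_def e_def)
    moreover have "f - h = (f - g) - smul c e" by (simp add: h_def)
    ultimately show ?thesis by (simp only: ip_diff_left[of _ "smul c e"] ip_scale_left) simp
  qed
  have he: "ip (f - h) e = 0"
  proof (cases "e = 0")
    case False
    then show ?thesis using eS[OF g_in]
      by (simp add: h_def ip_diff_left ip_add_left ip_scale_left c_def ip_self)
  qed simp
  have *: "ip (f - h) v = 0" if v: "v \<in> span (insert a S)" for v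
  proof -
    obtain k where k: "v - smul k a \<in> span S" using v by (auto simp: span_breakdown_eq)
    have "(v - smul k a) + smul k b \<in> span S"
      using k b_in by (intro span_add span_scale)
    then have "ip (f - h) ((v - smul k a) + smul k b + smul k e) = 0"
      by (simp only: ip_add_right[of _ "v - smul k a + smul k b"] hS he ip_scale_right) simp
    moreover have "v = (v - smul k a) + smul k b + smul k e"
      by (simp add: e_def scale_right_diff_distrib)
    ultimately show ?thesis by simp
  qed
  have "h \<in> span (insert a S)"
    unfolding h_def using g_in span_mono[of S "insert a S"] e_in
    by (intro span_add span_scale) auto
  with * show ?case by (auto simp: is_proj_def)
qed

lemma is_proj_orth_proj:
  assumes "finite S"
  shows "is_proj (span S) f (orth_proj ip (span S) f)"
proof -
  have "\<exists>!g. is_proj (span S) f g"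
    using ex_is_proj[OF assms] is_proj_unique[OF subspace_span] by blast
  from theI'[OF this] show ?thesis
    unfolding orth_proj_def is_proj_def .
qed

lemma orth_proj_eqI: "finite S \<Longrightarrow> is_proj (span S) f g \<Longrightarrow> orth_proj ip (span S) f = g"
  using is_proj_orth_proj is_proj_unique[OF subspace_span] by blast

lemma orth_proj_in: "finite S \<Longrightarrow> orth_proj ip (span S) f \<in> span S"
  and orth_proj_orth: "finite S \<Longrightarrow> h \<in> span S \<Longrightarrow> ip (f - orth_proj ip (span S) f) h = 0"
  using is_proj_orth_proj unfolding is_proj_def by blast+

lemma ip_orth_proj:
  "finite S \<Longrightarrow> h \<in> span S \<Longrightarrow> ip (orth_proj ip (span S) f) h = ip f h"
  using orth_proj_orth[of S h f] by (simp add: ip_diff_left)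

lemma orth_proj_id: "finite S \<Longrightarrow> f \<in> span S \<Longrightarrow> orth_proj ip (span S) f = f"
  by (rule orth_proj_eqI) (auto simp: is_proj_def)

lemma orth_proj_add:
  assumes "finite S"
  shows "orth_proj ip (span S) (f + g) = orth_proj ip (span S) f + orth_proj ip (span S) g"
  by (rule orth_proj_eqI[OF assms])
     (use assms in \<open>auto simp: is_proj_def orth_proj_in span_add ip_diff_left ip_add_left ip_orth_proj\<close>)

lemma orth_proj_scale:
  assumes "finite S"
  shows "orth_proj ip (span S) (smul a f) = smul a (orth_proj ip (span S) f)"
  by (rule orth_proj_eqI[OF assms])
     (use assms in \<open>auto simp: is_proj_def orth_proj_in span_scale ip_diff_left ip_scale_left ip_orth_proj\<close>)

lemma norm_orth_proj_le:
  assumes "finite S"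
  shows "norm (orth_proj ip (span S) f) \<le> norm f"
proof -
  let ?P = "orth_proj ip (span S) f"
  have "ip (f - ?P) ?P = 0" by (simp add: assms orth_proj_in orth_proj_orth)
  from pythagoras[OF this] have "(norm ?P)\<^sup>2 \<le> (norm f)\<^sup>2" by simp
  then show ?thesis by (rule power2_le_imp_le) simp
qed

end

section \<open>Sums of polynomially decaying weights\<close>

lemma powr_neg_le_diff:
  fixes x p :: real
  assumes "x > 0" "p > 1"
  shows "(x + 1) powr (- p) \<le> (x powr (1 - p) - (x + 1) powr (1 - p)) / (p - 1)"
proof -
  have "\<exists>z. x < z \<and> z < x + 1 \<and>
      (x + 1) powr (1 - p) - x powr (1 - p) = (x + 1 - x) * ((1 - p) * z powr (- p))"
    using assms by (intro MVT2) (auto intro!: derivative_eq_intros)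
  then obtain z where z: "x < z" "z < x + 1"
    and eq: "x powr (1 - p) - (x + 1) powr (1 - p) = (p - 1) * z powr (- p)"
    by (auto simp: algebra_simps)
  have "(x + 1) powr (- p) \<le> z powr (- p)"
    using z assms by (intro powr_mono2') auto
  then show ?thesis
    using assms by (simp add: eq)
qed

text \<open>Telescoping; the bound is the integral of \<open>x powr -p\<close> over \<open>[a, \<infinity>)\<close>.\<close>
lemma sum_powr_tail_le:
  fixes p :: real
  assumes "p > 1" "a \<ge> 1"
  shows "(\<Sum>k\<in>{a<..b}. real k powr (- p)) \<le> real a powr (1 - p) / (p - 1)"
proof (cases "a \<le> b")
  case True
  then have "(\<Sum>k\<in>{a<..b}. real k powr (- p)) \<le> (real a powr (1 - p) - real b powr (1 - p)) / (p - 1)"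
  proof (induction rule: dec_induct)
    case (step b)
    have "(\<Sum>k\<in>{a<..Suc b}. real k powr (- p))
        = (\<Sum>k\<in>{a<..b}. real k powr (- p)) + (real b + 1) powr (- p)"
      using step by (simp add: atLeastSucAtMost_greaterThanAtMost [symmetric] add.commute)
    also have "\<dots> \<le> (real a powr (1 - p) - real b powr (1 - p)) / (p - 1)
        + (real b powr (1 - p) - (real b + 1) powr (1 - p)) / (p - 1)"
      using step assms by (intro add_mono powr_neg_le_diff) auto
    finally show ?case by (simp add: add_divide_distrib [symmetric] add.commute)
  qed simp
  also have "\<dots> \<le> real a powr (1 - p) / (p - 1)"
    using assms by (intro divide_right_mono) auto
  finally show ?thesis .
qed (use assms in simp)

definition decay :: "real \<Rightarrow> nat \<Rightarrow> nat \<Rightarrow> real" where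
  "decay p j l = (1 + \<bar>real j - real l\<bar>) powr (- p)"

lemma decay_nonneg [simp]: "0 \<le> decay p j l"
  and decay_commute: "decay p j l = decay p l j"
  and decay_self [simp]: "decay p j j = 1"
  and decay_one: "j \<ge> 1 \<Longrightarrow> decay p j (Suc 0) = real j powr (- p)"
  by (simp_all add: decay_def abs_minus_commute powr_def)

lemma decay_power2: "(decay p j l)\<^sup>2 = decay (2 * p) j l"
  by (simp add: decay_def power2_eq_square flip: powr_add)

text \<open>For indices l on one side of j the distance from j determines l, so that a sum of weights becomes a
sum over the values g l of 1 + distance.\<close>
lemma sum_decay_tail_reindexed:
  assumes "p > 1" "N \<ge> 1" "finite F" "inj_on g F"
    and "\<And>l. l \<in> F \<Longrightarrow> real (g l) = 1 + \<bar>real j - real l\<bar>"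
    and "\<And>l. l \<in> F \<Longrightarrow> N < g l"
  shows "(\<Sum>l\<in>F. decay p j l) \<le> real N powr (1 - p) / (p - 1)"
proof -
  have "(\<Sum>l\<in>F. decay p j l) = (\<Sum>l\<in>F. real (g l) powr (- p))"
    using assms by (intro sum.cong) (auto simp: decay_def)
  also have "\<dots> = (\<Sum>k\<in>g ` F. real k powr (- p))"
    using assms by (simp add: sum.reindex)
  also have "\<dots> \<le> (\<Sum>k\<in>{N<..Max (g ` F)}. real k powr (- p))"
    using assms by (intro sum_mono2) auto
  also have "\<dots> \<le> real N powr (1 - p) / (p - 1)"
    using assms by (intro sum_powr_tail_le)
  finally show ?thesis .
qed

lemma sum_decay_above_le:
  assumes "p > 1" "N \<ge> 1" "finite F" "\<And>l. l \<in> F \<Longrightarrow> l \<ge> j + N"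
  shows "(\<Sum>l\<in>F. decay p j l) \<le> real N powr (1 - p) / (p - 1)"
proof (rule sum_decay_tail_reindexed[where g = "\<lambda>l. 1 + (l - j)"])
  show "inj_on (\<lambda>l. 1 + (l - j)) F"
    using assms(4) by (auto intro!: inj_onI) (metis add_leD1 eq_diff_iff)
  show "real (1 + (l - j)) = 1 + \<bar>real j - real l\<bar>" "N < 1 + (l - j)" if "l \<in> F" for l
    using assms(4)[OF that] by auto
qed (use assms in auto)

lemma sum_decay_below_le:
  assumes "p > 1" "N \<ge> 1" "finite F" "\<And>l. l \<in> F \<Longrightarrow> j \<ge> l + N"
  shows "(\<Sum>l\<in>F. decay p j l) \<le> real N powr (1 - p) / (p - 1)"
proof (rule sum_decay_tail_reindexed[where g = "\<lambda>l. 1 + (j - l)"])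
  show "inj_on (\<lambda>l. 1 + (j - l)) F"
    using assms(4) by (auto intro!: inj_onI) (metis add_leD1 diff_diff_cancel)
  show "real (1 + (j - l)) = 1 + \<bar>real j - real l\<bar>" "N < 1 + (j - l)" if "l \<in> F" for l
    using assms(4)[OF that] by auto
qed (use assms in auto)

lemma sum_decay_far_le:
  assumes "p > 1" "N \<ge> 1" "finite F" "\<And>l. l \<in> F \<Longrightarrow> j \<ge> l + N \<or> l \<ge> j + N"
  shows "(\<Sum>l\<in>F. decay p j l) \<le> 2 * real N powr (1 - p) / (p - 1)"
proof -
  have "(\<Sum>l\<in>F. decay p j l)
      = (\<Sum>l\<in>{l\<in>F. j \<ge> l + N}. decay p j l) + (\<Sum>l\<in>F - {l\<in>F. j \<ge> l + N}. decay p j l)"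
    using assms(3) by (subst sum.subset_diff[of "{l\<in>F. j \<ge> l + N}"]) auto
  also have "\<dots> \<le> real N powr (1 - p) / (p - 1) + real N powr (1 - p) / (p - 1)"
    using assms by (intro add_mono sum_decay_above_le sum_decay_below_le) auto
  finally show ?thesis by (simp add: field_simps)
qed

text \<open>Bounds the sum of the weights around any index: 1 for the index itself and \<open>1 / (p - 1)\<close> for
each side.\<close>
definition decay_sum_bound :: "real \<Rightarrow> real" where
  "decay_sum_bound p = 1 + 2 / (p - 1)"

lemma decay_sum_bound_ge_1: "p > 1 \<Longrightarrow> decay_sum_bound p \<ge> 1"
  by (simp add: decay_sum_bound_def)

lemma sum_decay_le:
  assumes "p > 1" "finite F"
  shows "(\<Sum>l\<in>F. decay p j l) \<le> decay_sum_bound p"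
proof -
  have "(\<Sum>l\<in>F. decay p j l) \<le> (\<Sum>l\<in>insert j (F - {j}). decay p j l)"
    using assms by (intro sum_mono2) auto
  also have "\<dots> = 1 + (\<Sum>l\<in>F - {j}. decay p j l)"
    using assms by (subst sum.insert) auto
  also have "(\<Sum>l\<in>F - {j}. decay p j l) \<le> 2 * real 1 powr (1 - p) / (p - 1)"
    using assms by (intro sum_decay_far_le) auto
  finally show ?thesis by (simp add: decay_sum_bound_def)
qed

text \<open>One of the two steps from j to k and from k to l is at least half as long as the step from j to l.
This is why polynomial off-diagonal decay is inherited by matrix products.\<close>
lemma decay_split:
  assumes "p > 0"
  shows "decay p j k \<le> 2 powr p * decay p j l \<or> decay p k l \<le> 2 powr p * decay p j l"
proof -
  have *: "x powr (- p) \<le> 2 powr p * y powr (- p)" if "y \<le> 2 * x" "y > 0" "x > 0" for x y :: real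
  proof -
    have "x powr (- p) \<le> (y / 2) powr (- p)"
      using that assms by (intro powr_mono2') auto
    also have "\<dots> = 2 powr p * y powr (- p)"
      using that by (simp add: powr_divide powr_minus field_simps)
    finally show ?thesis .
  qed
  have "1 + \<bar>real j - real l\<bar> \<le> 2 * (1 + \<bar>real j - real k\<bar>)
      \<or> 1 + \<bar>real j - real l\<bar> \<le> 2 * (1 + \<bar>real k - real l\<bar>)"
  proof -
    have "c \<le> a + b \<Longrightarrow> 1 + c \<le> 2 * (1 + a) \<or> 1 + c \<le> 2 * (1 + b)" for a b c :: real
      by argo
    then show ?thesis
      using abs_triangle_ineq[of "real j - real k" "real k - real l"] by simp
  qed
  then show ?thesis unfolding decay_def by (auto intro!: *)
qed

text \<open>One entry of a matrix product.  The decay constants a, b enter linearly, each multiplied by a mere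
sum bound of the other factor; this asymmetry is what the interpolation argument exploits.\<close>
lemma sum_mult_decay_le:
  assumes "p > 0" "finite F"
    and x: "\<And>k. k \<in> F \<Longrightarrow> 0 \<le> x k \<and> x k \<le> a * decay p j k"
    and y: "\<And>k. k \<in> F \<Longrightarrow> 0 \<le> y k \<and> y k \<le> b * decay p k l"
    and X: "(\<Sum>k\<in>F. x k) \<le> X" and Y: "(\<Sum>k\<in>F. y k) \<le> Y"
    and ab: "a \<ge> 0" "b \<ge> 0"
  shows "(\<Sum>k\<in>F. x k * y k) \<le> 2 powr p * (a * Y + b * X) * decay p j l"
proof -
  let ?D = "2 powr p * decay p j l"
  have "x k * y k \<le> ?D * (a * y k + b * x k)" if k: "k \<in> F" for k
  proof -
    have D0: "?D \<ge> 0" by simp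
    from decay_split[OF assms(1), of j k l] show ?thesis
    proof
      assume "decay p j k \<le> ?D"
      then have "x k \<le> a * ?D" using x[OF k] ab by (meson mult_left_mono order_trans)
      then have "x k * y k \<le> a * ?D * y k" using y[OF k] by (intro mult_right_mono) auto
      moreover have "0 \<le> ?D * (b * x k)" using x[OF k] ab D0 by (intro mult_nonneg_nonneg) auto
      ultimately show ?thesis by (simp add: algebra_simps)
    next
      assume "decay p k l \<le> ?D"
      then have "y k \<le> b * ?D" using y[OF k] ab by (meson mult_left_mono order_trans)
      then have "x k * y k \<le> x k * (b * ?D)" using x[OF k] by (intro mult_left_mono) auto
      moreover have "0 \<le> ?D * (a * y k)" using y[OF k] ab D0 by (intro mult_nonneg_nonneg) auto
      ultimately show ?thesis by (simp add: algebra_simps)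
    qed
  qed
  then have "(\<Sum>k\<in>F. x k * y k) \<le> (\<Sum>k\<in>F. ?D * (a * y k + b * x k))"
    by (rule sum_mono)
  also have "\<dots> = ?D * (a * (\<Sum>k\<in>F. y k) + b * (\<Sum>k\<in>F. x k))"
    by (simp add: sum_distrib_left sum.distrib distrib_left)
  also have "\<dots> \<le> ?D * (a * Y + b * X)"
    using X Y ab by (intro mult_left_mono add_mono) auto
  finally show ?thesis by (simp add: algebra_simps)
qed

text \<open>At most 2N indices have distance less than N from j; their contribution is bounded by
Cauchy-Schwarz.  The others are bounded by the decay.\<close>
lemma sum_near_far_le:
  assumes p: "p > 1" and N: "N \<ge> 1" and F: "finite F"
    and x: "\<And>l. l \<in> F \<Longrightarrow> 0 \<le> x l \<and> x l \<le> a * decay p j l"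
    and q: "(\<Sum>l\<in>F. (x l)\<^sup>2) \<le> q\<^sup>2" and aq: "a \<ge> 0" "q \<ge> 0"
  shows "(\<Sum>l\<in>F. x l) \<le> sqrt (2 * real N) * q + 2 * a * real N powr (1 - p) / (p - 1)"
proof -
  define G where "G = {l\<in>F. j < l + N \<and> l < j + N}"
  have G: "finite G" "G \<subseteq> F" using F by (auto simp: G_def)
  have "G \<subseteq> {j + 1 - N..<j + N}" by (auto simp: G_def)
  then have "card G \<le> card {j + 1 - N..<j + N}" by (intro card_mono) auto
  then have cG: "card G \<le> 2 * N" using N by simp
  have "(\<Sum>l\<in>G. x l)\<^sup>2 \<le> (\<Sum>l\<in>G. 1\<^sup>2) * (\<Sum>l\<in>G. (x l)\<^sup>2)"
    using Cauchy_Schwarz_ineq_sum[of "\<lambda>_. 1" x G] by simp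
  also have "\<dots> \<le> (2 * real N) * q\<^sup>2"
  proof (intro mult_mono)
    show "(\<Sum>l\<in>G. (x l)\<^sup>2) \<le> q\<^sup>2"
      using sum_mono2[OF F G(2), of "\<lambda>l. (x l)\<^sup>2"] q by auto
  qed (use cG in \<open>auto intro!: sum_nonneg\<close>)
  also have "\<dots> = (sqrt (2 * real N) * q)\<^sup>2" by (simp add: power_mult_distrib)
  finally have near: "(\<Sum>l\<in>G. x l) \<le> sqrt (2 * real N) * q"
    by (rule power2_le_imp_le) (use aq in simp)
  have "(\<Sum>l\<in>F - G. x l) \<le> (\<Sum>l\<in>F - G. a * decay p j l)"
    using x by (intro sum_mono) auto
  also have "\<dots> \<le> a * (2 * real N powr (1 - p) / (p - 1))"
    unfolding sum_distrib_left[symmetric]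
    by (intro mult_left_mono sum_decay_far_le) (use p N F aq in \<open>auto simp: G_def\<close>)
  finally have far: "(\<Sum>l\<in>F - G. x l) \<le> 2 * a * real N powr (1 - p) / (p - 1)"
    by (simp add: mult.left_commute[of a] mult.assoc)
  show ?thesis using near far sum.subset_diff[OF G(2) F, of x] by simp
qed

text \<open>The choice \<open>N = (a / q) powr (2 * \<theta>)\<close>, rounded up, balances the near part \<open>sqrt N * q\<close> and the far
part \<open>a * N powr (1 - p)\<close>: both become \<open>a powr \<theta> * q powr (1 - \<theta>)\<close>.\<close>
lemma sum_interpolation_le:
  assumes p: "p > 1" and F: "finite F"
    and x: "\<And>l. l \<in> F \<Longrightarrow> 0 \<le> x l \<and> x l \<le> a * decay p j l"
    and q: "(\<Sum>l\<in>F. (x l)\<^sup>2) \<le> q\<^sup>2" and aq: "0 < q" "q \<le> a"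
  defines "\<theta> \<equiv> 1 / (2 * p - 1)"
  shows "(\<Sum>l\<in>F. x l) \<le> 2 * decay_sum_bound p * a powr \<theta> * q powr (1 - \<theta>)"
proof -
  have a0: "a > 0" using aq by simp
  define y where "y = (a / q) powr (2 * \<theta>)"
  have th: "\<theta> > 0" "\<theta> < 1" using p by (auto simp: \<theta>_def)
  have y1: "y \<ge> 1" unfolding y_def using aq th by (intro ge_one_powr_ge_zero) auto
  define N where "N = nat \<lceil>y\<rceil>"
  have N: "N \<ge> 1" "y \<le> real N" "real N \<le> 2 * y" using y1 unfolding N_def by linarith+
  have "(\<Sum>l\<in>F. x l) \<le> sqrt (2 * real N) * q + 2 * a * real N powr (1 - p) / (p - 1)"
    using assms N by (intro sum_near_far_le) auto
  also have "\<dots> \<le> sqrt (4 * y) * q + 2 * a * y powr (1 - p) / (p - 1)"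
    using N y1 aq p by (intro add_mono mult_right_mono divide_right_mono mult_left_mono powr_mono2')
      (auto intro: real_sqrt_le_mono)
  also have "sqrt (4 * y) * q = 2 * (a powr \<theta> * q powr (1 - \<theta>))"
  proof -
    have "sqrt y = (a / q) powr \<theta>"
      unfolding y_def by (simp add: powr_half_sqrt[symmetric] powr_powr)
    then show ?thesis using aq a0
      by (simp add: real_sqrt_mult powr_divide powr_diff)
  qed
  also have "2 * a * y powr (1 - p) / (p - 1) = 2 / (p - 1) * (a powr \<theta> * q powr (1 - \<theta>))"
  proof -
    have e: "2 * \<theta> * (1 - p) = \<theta> - 1" using p by (simp add: \<theta>_def field_simps)
    have "y powr (1 - p) = (a / q) powr (\<theta> - 1)"
      unfolding y_def by (simp only: powr_powr e)
    also have "\<dots> = a powr \<theta> / a * q powr (1 - \<theta>)"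
      using aq a0 by (simp add: powr_divide powr_diff)
    finally show ?thesis using a0 by simp
  qed
  also have "2 * (a powr \<theta> * q powr (1 - \<theta>)) + 2 / (p - 1) * (a powr \<theta> * q powr (1 - \<theta>))
     = (2 + 2 / (p - 1)) * (a powr \<theta> * q powr (1 - \<theta>))" by (simp add: algebra_simps)
  also have "\<dots> \<le> (2 * decay_sum_bound p) * (a powr \<theta> * q powr (1 - \<theta>))"
    using p by (intro mult_right_mono) (auto simp: decay_sum_bound_def divide_right_mono)
  finally show ?thesis by (simp add: mult.assoc)
qed

section \<open>Self-adjoint operators and the frame operator\<close>

context separable_hilbert_space
begin

lemma tendsto_ip_right: "X \<longlonglongrightarrow> x \<Longrightarrow> (\<lambda>n. ip v (X n)) \<longlonglongrightarrow> ip v x"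
proof (rule LIM_zero_cancel, rule Lim_null_comparison)
  assume X: "X \<longlonglongrightarrow> x"
  show "\<forall>\<^sub>F n in sequentially. norm (ip v (X n) - ip v x) \<le> norm v * norm (X n - x)"
    by (simp add: norm_ip_le_cauchy_schwarz flip: ip_diff_right)
  show "(\<lambda>n. norm v * norm (X n - x)) \<longlonglongrightarrow> 0"
    using tendsto_mult_right_zero[OF tendsto_norm_zero[OF LIM_zero[OF X]]] .
qed

text \<open>The adjoint identity by itself makes an operator additive, as \<open>selfadj_add\<close> shows.\<close>
definition selfadj :: "('h \<Rightarrow> 'h) \<Rightarrow> bool" where
  "selfadj U \<longleftrightarrow> (\<forall>u v. ip (U u) v = ip u (U v))"

lemma selfadjD: "selfadj U \<Longrightarrow> ip (U u) v = ip u (U v)"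
  by (simp add: selfadj_def)

lemma selfadj_add: "selfadj U \<Longrightarrow> U (u + v) = U u + U v"
  by (rule eq_if_ip_eq) (simp add: ip_add_left selfadjD)

lemma selfadj_diff: "selfadj U \<Longrightarrow> U (u - v) = U u - U v"
  by (rule eq_if_ip_eq) (simp add: ip_diff_left selfadjD)

lemma selfadj_sum: "selfadj U \<Longrightarrow> U (sum f I) = (\<Sum>i\<in>I. U (f i))"
  by (rule eq_if_ip_eq) (simp add: ip_sum_left selfadjD)

lemma selfadj_comp:
  "selfadj U \<Longrightarrow> selfadj U' \<Longrightarrow> (\<And>u. U (U' u) = U' (U u)) \<Longrightarrow> selfadj (\<lambda>u. U (U' u))"
  by (simp add: selfadj_def)

lemma selfadj_sum_fun: "(\<And>i. i \<in> I \<Longrightarrow> selfadj (U i)) \<Longrightarrow> selfadj (\<lambda>u. \<Sum>i\<in>I. U i u)"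
  by (simp add: selfadj_def ip_sum_left ip_sum_right)

end

locale hilbert_frame = separable_hilbert_space smul ip
  for smul :: "'k::hilbert_scalar \<Rightarrow> 'h::banach \<Rightarrow> 'h" and ip :: "'h \<Rightarrow> 'h \<Rightarrow> 'k" +
  fixes \<phi> :: "nat \<Rightarrow> 'h" and A B :: real
  assumes frame: "is_frame ip \<phi> A B"
begin

lemma A_pos: "A > 0" and B_pos: "B > 0"
  using frame by (auto simp: is_frame_def)

lemma bessel:
  assumes "finite F" "F \<subseteq> {1..}"
  shows "(\<Sum>j\<in>F. (norm (ip f (\<phi> j)))\<^sup>2) \<le> B * (norm f)\<^sup>2"
proof -
  have "(\<Sum>j\<in>F. (norm (ip f (\<phi> j)))\<^sup>2) \<le> (\<Sum>\<^sub>\<infinity>j\<in>{1..}. (norm (ip f (\<phi> j)))\<^sup>2)"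
    using frame assms by (intro finite_sum_le_infsum) (auto simp: is_frame_def)
  also have "\<dots> \<le> B * (norm f)\<^sup>2"
    using frame by (auto simp: is_frame_def)
  finally show ?thesis .
qed

lemma frame_lower:
  assumes "\<And>M. (\<Sum>j=1..M. (norm (ip f (\<phi> j)))\<^sup>2) \<le> C"
  shows "A * (norm f)\<^sup>2 \<le> C"
proof -
  have "A * (norm f)\<^sup>2 \<le> (\<Sum>\<^sub>\<infinity>j\<in>{1..}. (norm (ip f (\<phi> j)))\<^sup>2)"
    using frame by (auto simp: is_frame_def)
  also have "\<dots> \<le> C"
  proof (rule infsum_le_finite_sums)
    show "(\<lambda>j. (norm (ip f (\<phi> j)))\<^sup>2) summable_on {1..}"
      using frame by (auto simp: is_frame_def)
    fix F :: "nat set" assume F: "finite F" "F \<subseteq> {1..}"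
    have "(\<Sum>j\<in>F. (norm (ip f (\<phi> j)))\<^sup>2) \<le> (\<Sum>j=1..Max F. (norm (ip f (\<phi> j)))\<^sup>2)"
      using F by (intro sum_mono2) auto
    with assms show "(\<Sum>j\<in>F. (norm (ip f (\<phi> j)))\<^sup>2) \<le> C" using order_trans by blast
  qed
  finally show ?thesis .
qed

text \<open>The bound on the synthesis operator follows by duality from Bessel's inequality: test the vector
against itself.\<close>
lemma norm_sum_smul_le:
  assumes "finite F" "F \<subseteq> {1..}"
  shows "(norm (\<Sum>j\<in>F. smul (c j) (\<phi> j)))\<^sup>2 \<le> B * (\<Sum>j\<in>F. (norm (c j))\<^sup>2)"
proof -
  define v where "v = (\<Sum>j\<in>F. smul (c j) (\<phi> j))"
  have "(norm v)\<^sup>2 = norm (ip v v)"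
    by (simp add: ip_self norm_power)
  also have "ip v v = (\<Sum>j\<in>F. c j * ip (\<phi> j) v)"
    by (subst v_def) (simp add: ip_sum_left ip_scale_left)
  also have "norm \<dots> \<le> (\<Sum>j\<in>F. norm (c j) * norm (ip v (\<phi> j)))"
    by (rule sum_norm_le) (simp add: norm_mult norm_ip_commute[of v])
  finally have "((norm v)\<^sup>2)\<^sup>2 \<le> (\<Sum>j\<in>F. norm (c j) * norm (ip v (\<phi> j)))\<^sup>2"
    by (intro power_mono) auto
  also have "\<dots> \<le> (\<Sum>j\<in>F. (norm (c j))\<^sup>2) * (\<Sum>j\<in>F. (norm (ip v (\<phi> j)))\<^sup>2)"
    by (rule Cauchy_Schwarz_ineq_sum)
  also have "\<dots> \<le> (\<Sum>j\<in>F. (norm (c j))\<^sup>2) * (B * (norm v)\<^sup>2)"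
    by (intro mult_left_mono bessel assms sum_nonneg) auto
  finally have "(norm v)\<^sup>2 * (norm v)\<^sup>2 \<le> (B * (\<Sum>j\<in>F. (norm (c j))\<^sup>2)) * (norm v)\<^sup>2"
    by (simp add: power2_eq_square mult_ac)
  then have "(norm v)\<^sup>2 \<le> B * (\<Sum>j\<in>F. (norm (c j))\<^sup>2)"
    using B_pos by (cases "v = 0") (simp_all only: mult_le_cancel_right, auto simp: sum_nonneg)
  then show ?thesis by (simp add: v_def)
qed

lemma norm_frame_elem_le:
  assumes "j \<ge> 1"
  shows "(norm (\<phi> j))\<^sup>2 \<le> B"
  using norm_sum_smul_le[of "{j}" "\<lambda>_. 1"] assms by simp

lemma norm_partial_frame_op_le: "norm (partial_frame_op smul ip \<phi> m f) \<le> B * norm f"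
proof (rule power2_le_imp_le)
  have "(norm (partial_frame_op smul ip \<phi> m f))\<^sup>2 \<le> B * (\<Sum>j=1..m. (norm (ip f (\<phi> j)))\<^sup>2)"
    unfolding partial_frame_op_def by (rule norm_sum_smul_le) auto
  also have "\<dots> \<le> B * (B * (norm f)\<^sup>2)"
    using B_pos by (intro mult_left_mono bessel) auto
  finally show "(norm (partial_frame_op smul ip \<phi> m f))\<^sup>2 \<le> (B * norm f)\<^sup>2"
    by (simp add: power2_eq_square mult_ac)
qed (use B_pos in simp)

lemma ip_partial_frame_op:
  "ip (partial_frame_op smul ip \<phi> m u) v = (\<Sum>j=1..m. ip u (\<phi> j) * ip (\<phi> j) v)"
  by (simp add: partial_frame_op_def ip_sum_left ip_scale_left)

lemma selfadj_partial_frame_op: "selfadj (partial_frame_op smul ip \<phi> m)"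
  unfolding selfadj_def ip_partial_frame_op
  by (simp add: partial_frame_op_def ip_sum_right ip_scale_right mult.commute ip_commute[symmetric])

lemma ip_partial_frame_op_self:
  "ip (partial_frame_op smul ip \<phi> m u) u = of_real (\<Sum>j=1..m. (norm (ip u (\<phi> j)))\<^sup>2)"
  by (simp add: ip_partial_frame_op ip_commute[of "\<phi> _" u] mult_sconj_eq del: of_real_power)

lemma summable_analysis: "summable (\<lambda>j. (norm (ip f (\<phi> (Suc j))))\<^sup>2)"
proof (rule bounded_imp_summable)
  fix n
  have "(\<Sum>j\<le>n. (norm (ip f (\<phi> (Suc j))))\<^sup>2) = (\<Sum>j\<in>Suc ` {..n}. (norm (ip f (\<phi> j)))\<^sup>2)"
    by (simp add: sum.reindex)
  also have "\<dots> \<le> B * (norm f)\<^sup>2" by (intro bessel) auto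
  finally show "(\<Sum>j\<le>n. (norm (ip f (\<phi> (Suc j))))\<^sup>2) \<le> B * (norm f)\<^sup>2" .
qed simp

lemma convergent_partial_frame_op: "convergent (\<lambda>m. partial_frame_op smul ip \<phi> m u)"
proof -
  have eq: "partial_frame_op smul ip \<phi> m u = (\<Sum>j<m. smul (ip u (\<phi> (Suc j))) (\<phi> (Suc j)))" for m
    unfolding partial_frame_op_def by (simp add: sum.atLeast1_atMost_eq)
  have "summable (\<lambda>j. smul (ip u (\<phi> (Suc j))) (\<phi> (Suc j)))"
    unfolding summable_Cauchy
  proof (intro allI impI)
    fix e :: real assume e: "e > 0"
    then have "e\<^sup>2 / B > 0" using B_pos by simp
    then obtain N where N: "\<And>m n. m \<ge> N \<Longrightarrow>
        norm (\<Sum>j\<in>{m..<n}. (norm (ip u (\<phi> (Suc j))))\<^sup>2) < e\<^sup>2 / B"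
      using summable_analysis[of u] unfolding summable_Cauchy by meson
    have "norm (\<Sum>j\<in>{m..<n}. smul (ip u (\<phi> (Suc j))) (\<phi> (Suc j))) < e" if "m \<ge> N" for m n
    proof (rule power2_less_imp_less)
      have "(\<Sum>j\<in>{m..<n}. smul (ip u (\<phi> (Suc j))) (\<phi> (Suc j))) = (\<Sum>j\<in>Suc ` {m..<n}. smul (ip u (\<phi> j)) (\<phi> j))"
        by (simp add: sum.reindex del: image_Suc_atLeastLessThan)
      also have "(norm \<dots>)\<^sup>2 \<le> B * (\<Sum>j\<in>Suc ` {m..<n}. (norm (ip u (\<phi> j)))\<^sup>2)"
        by (intro norm_sum_smul_le) auto
      also have "(\<Sum>j\<in>Suc ` {m..<n}. (norm (ip u (\<phi> j)))\<^sup>2) = (\<Sum>j\<in>{m..<n}. (norm (ip u (\<phi> (Suc j))))\<^sup>2)"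
        by (simp add: sum.reindex del: image_Suc_atLeastLessThan)
      also have "B * \<dots> < B * (e\<^sup>2 / B)"
        using N[OF that, of n] B_pos by (intro mult_strict_left_mono) auto
      finally show "(norm (\<Sum>j\<in>{m..<n}. smul (ip u (\<phi> (Suc j))) (\<phi> (Suc j))))\<^sup>2 < e\<^sup>2"
        using B_pos by simp
    qed (use e in simp)
    then show "\<exists>N. \<forall>m\<ge>N. \<forall>n. norm (\<Sum>j\<in>{m..<n}. smul (ip u (\<phi> (Suc j))) (\<phi> (Suc j))) < e"
      by blast
  qed
  then show ?thesis unfolding eq summable_iff_convergent .
qed

text \<open>The frame operator divided by the upper frame bound, so that \<open>0 \<le> K \<le> I\<close>.\<close>
definition K :: "'h \<Rightarrow> 'h" where
  "K u = (1 / B) *\<^sub>R lim (\<lambda>m. partial_frame_op smul ip \<phi> m u)"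

lemma tendsto_K: "(\<lambda>m. (1 / B) *\<^sub>R partial_frame_op smul ip \<phi> m u) \<longlonglongrightarrow> K u"
  unfolding K_def using convergent_partial_frame_op by (intro tendsto_intros) (simp add: convergent_LIMSEQ_iff)

lemma selfadj_K: "selfadj K"
  unfolding selfadj_def
proof (intro allI)
  fix u v
  have "(\<lambda>m. ip ((1 / B) *\<^sub>R partial_frame_op smul ip \<phi> m u) v) \<longlonglongrightarrow> ip (K u) v"
    by (intro tendsto_ip_left tendsto_K)
  moreover have "(\<lambda>m. ip u ((1 / B) *\<^sub>R partial_frame_op smul ip \<phi> m v)) \<longlonglongrightarrow> ip u (K v)"
    by (intro tendsto_ip_right tendsto_K)
  ultimately show "ip (K u) v = ip u (K v)"
    by (simp add: ip_scaleR_left ip_scaleR_right selfadjD[OF selfadj_partial_frame_op] LIMSEQ_unique)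
qed

text \<open>The form \<open>\<langle>K u, v\<rangle>\<close> is the limit of the sums of \<open>\<langle>u, \<phi>\<^sub>j\<rangle> \<langle>\<phi>\<^sub>j, v\<rangle> / B\<close>; all estimates of matrix products
and of coefficients of \<open>K u\<close> go through this bound.\<close>
lemma norm_ip_K_le:
  assumes "\<And>M. (\<Sum>j=1..M. norm (ip u (\<phi> j)) * norm (ip (\<phi> j) v)) \<le> B * C"
  shows "norm (ip (K u) v) \<le> C"
proof (rule LIMSEQ_le_const2)
  show "(\<lambda>m. norm (ip ((1 / B) *\<^sub>R partial_frame_op smul ip \<phi> m u) v)) \<longlonglongrightarrow> norm (ip (K u) v)"
    by (intro tendsto_norm tendsto_ip_left tendsto_K)
  have "norm (ip ((1 / B) *\<^sub>R partial_frame_op smul ip \<phi> m u) v) \<le> C" for m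
  proof -
    have "norm (ip (partial_frame_op smul ip \<phi> m u) v)
        \<le> (\<Sum>j=1..m. norm (ip u (\<phi> j)) * norm (ip (\<phi> j) v))"
      unfolding ip_partial_frame_op by (rule sum_norm_le) (simp add: norm_mult)
    also have "\<dots> \<le> B * C" by (rule assms)
    finally show ?thesis using B_pos
      by (simp add: ip_scaleR_left norm_mult norm_divide field_simps)
  qed
  then show "\<exists>N. \<forall>m\<ge>N. norm (ip ((1 / B) *\<^sub>R partial_frame_op smul ip \<phi> m u) v) \<le> C"
    by blast
qed

text \<open>The last property is \<open>K\<^sup>2 \<le> K\<close>; it gives the norm of \<open>I - K\<close> without any spectral theory.\<close>
lemma K_form_bounds:
  obtains \<kappa> where "ip (K u) u = of_real \<kappa>" "A / B * (norm u)\<^sup>2 \<le> \<kappa>" "(norm (K u))\<^sup>2 \<le> \<kappa>"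
proof -
  define \<sigma> where "\<sigma> m = (\<Sum>j=1..m. (norm (ip u (\<phi> j)))\<^sup>2)" for m
  define s where "s = (\<Sum>j. (norm (ip u (\<phi> (Suc j))))\<^sup>2)"
  have \<sigma>_eq: "\<sigma> m = (\<Sum>j<m. (norm (ip u (\<phi> (Suc j))))\<^sup>2)" for m
    by (simp add: \<sigma>_def sum.atLeast1_atMost_eq)
  have lim: "\<sigma> \<longlonglongrightarrow> s"
    unfolding \<sigma>_eq s_def by (rule summable_LIMSEQ[OF summable_analysis])
  have le: "\<sigma> m \<le> s" for m
    unfolding \<sigma>_eq s_def by (rule sum_le_suminf[OF summable_analysis]) auto
  have "(\<lambda>m. ip ((1 / B) *\<^sub>R partial_frame_op smul ip \<phi> m u) u) \<longlonglongrightarrow> ip (K u) u"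
    by (intro tendsto_ip_left tendsto_K)
  moreover have "(\<lambda>m. of_real (1 / B * \<sigma> m) :: 'k) \<longlonglongrightarrow> of_real (1 / B * s)"
    by (intro tendsto_intros lim)
  ultimately have 1: "ip (K u) u = of_real (s / B)"
    by (simp add: ip_scaleR_left ip_partial_frame_op_self \<sigma>_def LIMSEQ_unique)
  have "A * (norm u)\<^sup>2 \<le> s"
    using le unfolding \<sigma>_def by (rule frame_lower)
  then have 2: "A / B * (norm u)\<^sup>2 \<le> s / B"
    using B_pos by (simp add: divide_right_mono)
  have "(norm ((1 / B) *\<^sub>R partial_frame_op smul ip \<phi> m u))\<^sup>2 \<le> s / B" for m
  proof -
    have "(norm (partial_frame_op smul ip \<phi> m u))\<^sup>2 \<le> B * \<sigma> m"
      unfolding partial_frame_op_def \<sigma>_def by (rule norm_sum_smul_le) auto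
    also have "\<dots> \<le> B * s" using le B_pos by simp
    finally show ?thesis using B_pos
      by (simp add: power_mult_distrib power_divide power2_eq_square field_simps)
  qed
  then have 3: "(norm (K u))\<^sup>2 \<le> s / B"
    by (intro LIMSEQ_le_const2[OF tendsto_power[OF tendsto_norm[OF tendsto_K]]]) blast
  from 1 2 3 show thesis by (rule that)
qed

text \<open>A contraction rate of \<open>I - K\<close>.  It is kept away from 0 because powers of it are used as bounds on the
Euclidean norms of rows in the interpolation, which have to be positive.\<close>
definition r :: real where
  "r = sqrt (max (1/4) (1 - A / B))"

lemma r_bounds: "1 / 2 \<le> r" "r < 1" "0 < r"
proof -
  have "sqrt (1/4) \<le> r" unfolding r_def by (intro real_sqrt_le_mono) auto
  then show "1 / 2 \<le> r" by (simp add: real_sqrt_divide)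
  then show "0 < r" by simp
  show "r < 1" using A_pos B_pos by (simp add: r_def)
qed

definition T :: "nat \<Rightarrow> 'h \<Rightarrow> 'h" where
  "T k = ((\<lambda>u. u - K u) ^^ k)"

lemma T_0 [simp]: "T 0 u = u"
  and T_Suc: "T (Suc k) u = T k u - K (T k u)"
  by (simp_all add: T_def)

lemma T_add: "T (i + j) u = T i (T j u)"
  by (simp add: T_def funpow_add)

lemma selfadj_I_minus_K: "selfadj (\<lambda>u. u - K u)"
  using selfadj_K by (simp add: selfadj_def ip_diff_left ip_diff_right)

lemma K_T: "K (T k u) = T k (K u)"
  by (induction k) (auto simp: T_Suc selfadj_diff[OF selfadj_K])

lemma selfadj_T: "selfadj (T k)"
proof (induction k)
  case 0
  then show ?case by (simp add: selfadj_def)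
next
  case (Suc k)
  have "selfadj (\<lambda>u. (\<lambda>u. u - K u) (T k u))"
    by (rule selfadj_comp[OF selfadj_I_minus_K Suc]) (simp add: selfadj_diff[OF Suc] K_T)
  then show ?case by (simp add: T_Suc selfadj_def)
qed

text \<open>\<open>\<parallel>u - K u\<parallel>\<^sup>2 = \<parallel>u\<parallel>\<^sup>2 - 2 \<langle>K u, u\<rangle> + \<parallel>K u\<parallel>\<^sup>2 \<le> \<parallel>u\<parallel>\<^sup>2 - \<langle>K u, u\<rangle>\<close>.\<close>
lemma norm_I_minus_K: "norm (u - K u) \<le> r * norm u"
proof (rule power2_le_imp_le)
  obtain \<kappa> where \<kappa>: "ip (K u) u = of_real \<kappa>" "A / B * (norm u)\<^sup>2 \<le> \<kappa>" "(norm (K u))\<^sup>2 \<le> \<kappa>"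
    by (rule K_form_bounds)
  have "ip u (K u) = of_real \<kappa>" using \<kappa>(1) selfadjD[OF selfadj_K] by metis
  then have "ip (u - K u) (u - K u) = of_real ((norm u)\<^sup>2 - 2 * \<kappa> + (norm (K u))\<^sup>2)"
    unfolding ip_diff_left ip_diff_right using \<kappa>(1) by (simp add: ip_self)
  then have "(norm (u - K u))\<^sup>2 = (norm u)\<^sup>2 - 2 * \<kappa> + (norm (K u))\<^sup>2"
    by (rule norm_sq_eq_of_ip)
  also have "\<dots> \<le> (1 - A / B) * (norm u)\<^sup>2"
    using \<kappa> by (simp add: algebra_simps)
  also have "\<dots> \<le> max (1/4) (1 - A / B) * (norm u)\<^sup>2"
    by (intro mult_right_mono) auto
  finally show "(norm (u - K u))\<^sup>2 \<le> (r * norm u)\<^sup>2"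
    by (simp add: r_def power_mult_distrib)
qed (use r_bounds in simp)

lemma norm_T_le: "norm (T k u) \<le> r ^ k * norm u"
proof (induction k)
  case (Suc k)
  have "norm (T (Suc k) u) \<le> r * norm (T k u)"
    by (simp add: T_Suc norm_I_minus_K)
  also have "\<dots> \<le> r * (r ^ k * norm u)"
    using Suc r_bounds by (intro mult_left_mono) auto
  finally show ?case by simp
qed simp

text \<open>A solution g of \<open>K g = f\<close> is a fixed point of the contraction \<open>x - K x + f\<close>.\<close>
lemma K_surj: "\<exists>g. K g = f"
proof -
  have "\<exists>!x. (x - K x) + f = x"
  proof (rule banach_fix_type[of r])
    show "\<forall>x y. dist ((x - K x) + f) ((y - K y) + f) \<le> r * dist x y"
    proof (intro allI)
      fix x y
      have "((x - K x) + f) - ((y - K y) + f) = (x - y) - K (x - y)"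
        by (simp add: selfadj_diff[OF selfadj_K, of x y])
      then show "dist ((x - K x) + f) ((y - K y) + f) \<le> r * dist x y"
        unfolding dist_norm by (simp only: norm_I_minus_K)
    qed
  qed (use r_bounds in auto)
  then obtain x where "(x - K x) + f = x" by blast
  then have "K x = f" by (simp add: algebra_simps)
  then show ?thesis by blast
qed

text \<open>The partial sums of the Neumann series of the inverse of K.  In terms of the matrix R = I - M of the
introduction, the matrix of L k is \<open>I - R\<^sup>k\<close>, and that of T k is \<open>M R\<^sup>k\<close>.\<close>
definition L :: "nat \<Rightarrow> 'h \<Rightarrow> 'h" where
  "L k u = (\<Sum>i<k. T i u)"

lemma selfadj_L: "selfadj (L k)"
  unfolding L_def by (intro selfadj_sum_fun selfadj_T)

lemma K_L: "K (L k u) = u - T k u"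
proof -
  have "K (L k u) = (\<Sum>i<k. T i u - T (Suc i) u)"
    by (simp add: L_def selfadj_sum[OF selfadj_K] T_Suc)
  then show ?thesis using sum_lessThan_telescope'[of "\<lambda>i. T i u" k] by simp
qed

text \<open>This is \<open>R\<^sup>i\<^sup>+\<^sup>j = R\<^sup>i R\<^sup>j\<close> for \<open>R\<^sup>k = I - L k\<close>, where matrix multiplication is \<open>U K V\<close>.\<close>
lemma L_add: "L (i + j) u = L i u + L j u - L i (K (L j u))"
proof -
  have "L (i + j) u = L j u + L i (T j u)"
    by (induction i) (simp_all add: L_def flip: T_add)
  then show ?thesis by (simp add: K_L selfadj_diff[OF selfadj_L])
qed

lemma norm_L_le: "norm (L k u) \<le> 1 / (1 - r) * norm u"
proof -
  have "norm (L k u) \<le> (\<Sum>i<k. r ^ i * norm u)"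
    unfolding L_def by (rule sum_norm_le) (rule norm_T_le)
  also have "\<dots> = (\<Sum>i<k. r ^ i) * norm u"
    by (simp add: sum_distrib_right)
  also have "(\<Sum>i<k. r ^ i) \<le> 1 / (1 - r)"
    using r_bounds by (simp add: sum_gp_strict divide_right_mono)
  finally show ?thesis by (simp add: mult_right_mono)
qed

section \<open>Matrices of operators with respect to a frame\<close>

definition entry :: "('h \<Rightarrow> 'h) \<Rightarrow> nat \<Rightarrow> nat \<Rightarrow> 'k" where
  "entry U j l = ip (U (\<phi> l)) (\<phi> j) / of_real B"

lemma norm_entry: "norm (entry U j l) = norm (ip (U (\<phi> l)) (\<phi> j)) / B"
  using B_pos by (simp add: entry_def norm_divide)

lemma norm_entry_commute: "selfadj U \<Longrightarrow> norm (entry U j l) = norm (entry U l j)"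
  by (simp add: norm_entry selfadjD norm_ip_commute[of "\<phi> l"])

text \<open>Bounds on \<open>\<H>\<close> carry over to the rows of the matrix: a row consists of the frame coefficients of
one vector \<open>U \<phi>\<^sub>j\<close>, up to conjugation.\<close>
lemma entry_row_l2:
  assumes "selfadj U" "\<And>u. norm (U u) \<le> \<kappa> * norm u" "\<kappa> \<ge> 0" "j \<ge> 1" "finite F" "F \<subseteq> {1..}"
  shows "(\<Sum>l\<in>F. (norm (entry U j l))\<^sup>2) \<le> \<kappa>\<^sup>2"
proof -
  have "(\<Sum>l\<in>F. (norm (entry U j l))\<^sup>2) = (\<Sum>l\<in>F. (norm (ip (U (\<phi> j)) (\<phi> l)))\<^sup>2) / B\<^sup>2"
    unfolding norm_entry_commute[OF assms(1), of j]
    by (simp add: norm_entry power_divide sum_divide_distrib)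
  also have "\<dots> \<le> (B * (norm (U (\<phi> j)))\<^sup>2) / B\<^sup>2"
    using assms by (intro divide_right_mono bessel) auto
  also have "\<dots> \<le> (B * (\<kappa>\<^sup>2 * B)) / B\<^sup>2"
  proof -
    have "(norm (U (\<phi> j)))\<^sup>2 \<le> (\<kappa> * norm (\<phi> j))\<^sup>2"
      using assms by (intro power_mono) auto
    also have "\<dots> \<le> \<kappa>\<^sup>2 * B"
      using norm_frame_elem_le[OF assms(4)] by (simp add: power_mult_distrib mult_left_mono)
    finally show ?thesis using B_pos by (intro divide_right_mono mult_left_mono) auto
  qed
  also have "\<dots> = \<kappa>\<^sup>2" using B_pos by (simp add: power2_eq_square)
  finally show ?thesis .
qed

text \<open>The matrix of \<open>U K V\<close> is the product of the matrices of U and V.\<close>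
lemma norm_entry_comp_le:
  assumes "selfadj U" "\<And>M. (\<Sum>k=1..M. norm (entry U j k) * norm (entry U' k l)) \<le> C"
  shows "norm (entry (\<lambda>u. U (K (U' u))) j l) \<le> C"
proof -
  have "norm (ip (K (U' (\<phi> l))) (U (\<phi> j))) \<le> B * C"
  proof (rule norm_ip_K_le)
    fix M
    have "(\<Sum>k=1..M. norm (ip (U' (\<phi> l)) (\<phi> k)) * norm (ip (\<phi> k) (U (\<phi> j))))
        = B\<^sup>2 * (\<Sum>k=1..M. norm (entry U j k) * norm (entry U' k l))"
      using B_pos by (simp add: norm_entry selfadjD[OF assms(1)] sum_distrib_left power2_eq_square mult.commute)
    also have "\<dots> \<le> B\<^sup>2 * C" using assms(2)[of M] by (intro mult_left_mono) auto
    finally show "(\<Sum>k=1..M. norm (ip (U' (\<phi> l)) (\<phi> k)) * norm (ip (\<phi> k) (U (\<phi> j)))) \<le> B * (B * C)"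
      by (simp add: power2_eq_square mult.assoc)
  qed
  then show ?thesis using B_pos by (simp add: norm_entry selfadjD[OF assms(1)] field_simps)
qed

end

section \<open>Subexponential growth from a subquadratic doubling estimate\<close>

lemma exp_doubling_subexponential:
  fixes \<theta> \<gamma> \<nu> \<beta> :: real
  assumes "0 < \<theta>" "\<theta> < 1" "\<nu> > 0" "\<beta> > 1"
  shows "\<exists>n. 1 + \<nu> * exp (\<gamma> * (1 + \<theta>) ^ n) \<le> \<beta> ^ (2 ^ n)"
proof -
  define \<gamma>' where "\<gamma>' = max 0 \<gamma>"
  have "(\<lambda>n. ln (1 + \<nu>) * (1 / 2) ^ n + \<gamma>' * ((1 + \<theta>) / 2) ^ n) \<longlonglongrightarrow> ln (1 + \<nu>) * 0 + \<gamma>' * 0"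
    using assms by (intro tendsto_intros LIMSEQ_realpow_zero) auto
  moreover have "ln (1 + \<nu>) * 0 + \<gamma>' * 0 < ln \<beta>" using assms by simp
  ultimately have "\<forall>\<^sub>F n in sequentially.
      ln (1 + \<nu>) * (1 / 2) ^ n + \<gamma>' * ((1 + \<theta>) / 2) ^ n < ln \<beta>"
    by (rule order_tendstoD)
  then obtain n where n: "ln (1 + \<nu>) * (1 / 2) ^ n + \<gamma>' * ((1 + \<theta>) / 2) ^ n < ln \<beta>"
    unfolding eventually_sequentially by blast
  from n have *: "ln (1 + \<nu>) + \<gamma>' * (1 + \<theta>) ^ n < 2 ^ n * ln \<beta>"
    by (simp add: power_divide add_divide_distrib[symmetric] pos_divide_less_eq mult.commute)
  have "\<gamma> * (1 + \<theta>) ^ n \<le> \<gamma>' * (1 + \<theta>) ^ n"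
    using assms by (intro mult_right_mono) (auto simp: \<gamma>'_def)
  then have "exp (\<gamma> * (1 + \<theta>) ^ n) \<le> exp (\<gamma>' * (1 + \<theta>) ^ n)" by simp
  moreover have "1 \<le> exp (\<gamma>' * (1 + \<theta>) ^ n)"
    using assms by (simp add: \<gamma>'_def)
  ultimately have "1 + \<nu> * exp (\<gamma> * (1 + \<theta>) ^ n)
      \<le> exp (\<gamma>' * (1 + \<theta>) ^ n) + \<nu> * exp (\<gamma>' * (1 + \<theta>) ^ n)"
    using assms by (intro add_mono mult_left_mono) auto
  also have "\<dots> = exp (ln (1 + \<nu>) + \<gamma>' * (1 + \<theta>) ^ n)"
    using assms by (simp add: exp_add algebra_simps)
  also have "\<dots> \<le> exp (2 ^ n * ln \<beta>)" using * by simp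
  also have "\<dots> = \<beta> ^ (2 ^ n)"
    using assms exp_of_nat_mult[of "2 ^ n" "ln \<beta>"] by simp
  finally show ?thesis by blast
qed

text \<open>Read \<open>P k a\<close> as: the k-th power of some element of an algebra has norm at most a, up to
adding the unit.  The doubling estimate gives the bounds b n for the powers \<open>2 ^ n\<close>, whose
logarithms grow like \<open>(1 + \<theta>) ^ n\<close> only.  Submultiplicativity then extends the bound for a single
such power, the m-th, to all exponents, by division with remainder by m.\<close>
lemma subexponential_growth:
  fixes P :: "nat \<Rightarrow> real \<Rightarrow> bool" and \<theta> \<nu> \<beta> Q D e :: real
  assumes mono: "\<And>k a b. P k a \<Longrightarrow> a \<le> b \<Longrightarrow> P k b"
    and P0: "P 0 0" and P1: "P 1 e"
    and dbl: "\<And>k a. a \<ge> Q \<Longrightarrow> P k a \<Longrightarrow> P (2 * k) (D * a powr (1 + \<theta>))"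
    and addP: "\<And>i j a b. P i a \<Longrightarrow> P j b \<Longrightarrow> a \<ge> 0 \<Longrightarrow> b \<ge> 0 \<Longrightarrow> P (i + j) (a + b + \<nu> * a * b)"
    and cs: "Q \<ge> 1" "D \<ge> 1" "0 < \<theta>" "\<theta> < 1" "\<nu> > 0" "\<beta> > 1"
  shows "\<exists>C>0. \<forall>k. P k (C * \<beta> ^ k)"
proof -
  define q where "q = max e Q"
  have q: "q \<ge> 1" "q \<ge> e" "q \<ge> Q" using cs by (auto simp: q_def)
  \<comment> \<open>the normalisation for which the recursion of the bounds has the closed form b\<close>
  define c where "c = D powr (- (1 / \<theta>))"
  have c: "0 < c" "c \<le> 1"
    using cs by (auto simp: c_def powr_minus inverse_le_1_iff intro: ge_one_powr_ge_zero)
  define \<gamma> where "\<gamma> = ln (q / c)"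
  have g0: "\<gamma> \<ge> 0" using c q by (simp add: \<gamma>_def)
  define b where "b n = c * exp (\<gamma> * (1 + \<theta>) ^ n)" for n :: nat
  have b_rec: "D * b n powr (1 + \<theta>) = b (Suc n)" for n
  proof -
    have "D * c powr (1 + \<theta>) = c"
    proof -
      have "- (1 / \<theta>) * (1 + \<theta>) = - (1 / \<theta>) - 1" using cs by (simp add: field_simps)
      then have "c powr (1 + \<theta>) = D powr (- (1 / \<theta>) - 1)" by (simp only: c_def powr_powr)
      then show ?thesis using cs by (simp add: c_def powr_diff)
    qed
    then have "D * (c powr (1 + \<theta>) * exp (\<gamma> * (1 + \<theta>) ^ n) powr (1 + \<theta>)) = c * exp (\<gamma> * (1 + \<theta>) ^ n) powr (1 + \<theta>)"
      by (simp add: mult.assoc[symmetric])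
    moreover have "exp (\<gamma> * (1 + \<theta>) ^ n) powr (1 + \<theta>) = exp (\<gamma> * (1 + \<theta>) ^ Suc n)"
      by (simp add: powr_def mult_ac)
    ultimately show ?thesis using c by (simp add: b_def powr_mult)
  qed
  have b_ge: "b n \<ge> q" for n
  proof -
    have "\<gamma> * 1 \<le> \<gamma> * (1 + \<theta>) ^ n"
      using g0 cs by (intro mult_left_mono one_le_power) auto
    then have "exp \<gamma> \<le> exp (\<gamma> * (1 + \<theta>) ^ n)" by simp
    moreover have "exp \<gamma> = q / c" using c q by (simp add: \<gamma>_def)
    ultimately show ?thesis using c by (simp add: b_def field_simps)
  qed
  have pow: "P (2 ^ n) (b n)" for n
  proof (induction n)
    case 0
    then show ?case using mono[OF P1, of "b 0"] b_ge[of 0] q by simp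
  next
    case (Suc n)
    then show ?case using dbl[of "b n" "2 ^ n"] b_ge[of n] q by (simp add: b_rec)
  qed
  obtain n where n: "1 + \<nu> * exp (\<gamma> * (1 + \<theta>) ^ n) \<le> \<beta> ^ (2 ^ n)"
    using exp_doubling_subexponential cs by blast
  define m :: nat where "m = 2 ^ n"
  have m: "m > 0" by (simp add: m_def)
  have "b n \<le> 1 * exp (\<gamma> * (1 + \<theta>) ^ n)"
    unfolding b_def using c by (intro mult_right_mono) auto
  then have "1 + \<nu> * b n \<le> 1 + \<nu> * exp (\<gamma> * (1 + \<theta>) ^ n)" using cs by simp
  with n have bm: "1 + \<nu> * b n \<le> \<beta> ^ m" by (simp add: m_def)
  have "\<exists>a\<ge>0. P i a" for i
  proof (induction i)
    case (Suc i)
    then obtain a where "a \<ge> 0" "P i a" by blast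
    then have "P (Suc i) (a + q + \<nu> * a * q)"
      using addP[of i a 1 q] mono[OF P1, of q] q by simp
    then show ?case using q cs \<open>a \<ge> 0\<close> by (intro exI[of _ "a + q + \<nu> * a * q"]) auto
  qed (use P0 in auto)
  then obtain \<alpha> where \<alpha>: "\<And>i. \<alpha> i \<ge> 0" "\<And>i. P i (\<alpha> i)" by metis
  \<comment> \<open>In terms of \<open>1 + \<nu> a\<close> the composition rule is multiplication of the bounds.\<close>
  define M where "M = 1 + \<nu> * (\<Sum>i<m. \<alpha> i)"
  have M: "M \<ge> 1" using \<alpha> cs by (simp add: M_def sum_nonneg)
  have main: "P (s * m + i) ((M * (1 + \<nu> * b n) ^ s - 1) / \<nu>)" if "i < m" for s i
  proof (induction s)
    case 0
    have "\<alpha> i \<le> (\<Sum>i<m. \<alpha> i)" using \<alpha> that by (intro member_le_sum) auto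
    then show ?case using mono[OF \<alpha>(2)] cs by (simp add: M_def)
  next
    case (Suc s)
    let ?Y = "M * (1 + \<nu> * b n) ^ s"
    have b0: "b n \<ge> 0" using b_ge[of n] q by simp
    have "1 * 1 \<le> ?Y" using M b0 cs by (intro mult_mono one_le_power) auto
    then have "P (m + (s * m + i)) (b n + (?Y - 1) / \<nu> + \<nu> * b n * ((?Y - 1) / \<nu>))"
      using cs b0 by (intro addP Suc pow[of n, folded m_def]) auto
    moreover have "b n + (?Y - 1) / \<nu> + \<nu> * b n * ((?Y - 1) / \<nu>) = ((1 + \<nu> * b n) * ?Y - 1) / \<nu>"
      using cs by (simp add: field_simps)
    ultimately show ?case by (simp add: algebra_simps)
  qed
  have "P k (M / \<nu> * \<beta> ^ k)" for k
  proof (rule mono)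
    show "P k ((M * (1 + \<nu> * b n) ^ (k div m) - 1) / \<nu>)"
      using main[of "k mod m" "k div m"] m by simp
    have b0: "b n \<ge> 0" using b_ge[of n] q by simp
    have "(1 + \<nu> * b n) ^ (k div m) \<le> (\<beta> ^ m) ^ (k div m)"
      using bm b0 cs by (intro power_mono) auto
    also have "\<dots> = \<beta> ^ (m * (k div m))" by (simp add: power_mult)
    also have "\<dots> \<le> \<beta> ^ k" using cs by (intro power_increasing) auto
    finally have "M * (1 + \<nu> * b n) ^ (k div m) \<le> M * \<beta> ^ k" using M by simp
    then have "M * (1 + \<nu> * b n) ^ (k div m) - 1 \<le> M * \<beta> ^ k" by simp
    then show "(M * (1 + \<nu> * b n) ^ (k div m) - 1) / \<nu> \<le> M / \<nu> * \<beta> ^ k"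
      using cs by (simp add: divide_right_mono)
  qed
  moreover have "M / \<nu> > 0" using M cs by simp
  ultimately show ?thesis by blast
qed

section \<open>Inverse-closedness of polynomial off-diagonal decay\<close>

context hilbert_frame
begin

text \<open>Membership in the Jaffard algebra, with a bound on the norm.  The matrix of the identity operator is
the Gram matrix of the frame divided by the upper frame bound, so decay of the Gram matrix is decay
for \<open>\<lambda>u. u\<close>.\<close>
definition off_diag_decay :: "real \<Rightarrow> ('h \<Rightarrow> 'h) \<Rightarrow> real \<Rightarrow> bool" where
  "off_diag_decay p U a \<longleftrightarrow> (\<forall>j\<ge>1. \<forall>l\<ge>1. norm (entry U j l) \<le> a * decay p j l)"

definition row_sum_le :: "('h \<Rightarrow> 'h) \<Rightarrow> real \<Rightarrow> bool" where
  "row_sum_le U X \<longleftrightarrow> (\<forall>j\<ge>1. \<forall>M. (\<Sum>l=1..M. norm (entry U j l)) \<le> X)"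

lemma off_diag_decay_mono: "off_diag_decay p U a \<Longrightarrow> a \<le> b \<Longrightarrow> off_diag_decay p U b"
  unfolding off_diag_decay_def by (meson decay_nonneg mult_right_mono order_trans)

lemma off_diag_decay_add:
  assumes "off_diag_decay p U a" "off_diag_decay p V b" "\<And>u. W u = U u + V u"
  shows "off_diag_decay p W (a + b)"
  unfolding off_diag_decay_def
proof (intro allI impI)
  fix j l :: nat assume "j \<ge> 1" "l \<ge> 1"
  then have "norm (entry U j l) \<le> a * decay p j l" "norm (entry V j l) \<le> b * decay p j l"
    using assms by (auto simp: off_diag_decay_def)
  moreover have "entry W j l = entry U j l + entry V j l"
    by (simp add: entry_def assms(3) ip_add_left add_divide_distrib)
  ultimately show "norm (entry W j l) \<le> (a + b) * decay p j l"
    by (simp add: distrib_right norm_triangle_mono)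
qed

lemma off_diag_decay_diff:
  assumes "off_diag_decay p U a" "off_diag_decay p V b" "\<And>u. W u = U u - V u"
  shows "off_diag_decay p W (a + b)"
proof (rule off_diag_decay_add[OF assms(1)])
  show "off_diag_decay p (\<lambda>u. - V u) b"
    using assms(2) by (simp add: off_diag_decay_def norm_entry ip_minus_left)
qed (use assms(3) in simp)

lemma row_sum_le_of_decay:
  assumes "off_diag_decay p U a" "p > 1" "a \<ge> 0"
  shows "row_sum_le U (a * decay_sum_bound p)"
  unfolding row_sum_le_def
proof (intro allI impI)
  fix j M :: nat assume "j \<ge> 1"
  then have "(\<Sum>l=1..M. norm (entry U j l)) \<le> (\<Sum>l=1..M. a * decay p j l)"
    using assms by (intro sum_mono) (auto simp: off_diag_decay_def)
  also have "\<dots> = a * (\<Sum>l=1..M. decay p j l)" by (simp add: sum_distrib_left)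
  also have "\<dots> \<le> a * decay_sum_bound p"
    using assms by (intro mult_left_mono sum_decay_le) auto
  finally show "(\<Sum>l=1..M. norm (entry U j l)) \<le> a * decay_sum_bound p" .
qed

lemma row_sum_interpolation:
  assumes "off_diag_decay p U a" "p > 1" "selfadj U" "\<And>u. norm (U u) \<le> \<kappa> * norm u"
    and "0 < \<kappa>" "\<kappa> \<le> a" and th: "\<theta> = 1 / (2 * p - 1)"
  shows "row_sum_le U (2 * decay_sum_bound p * a powr \<theta> * \<kappa> powr (1 - \<theta>))"
  unfolding row_sum_le_def th
proof (intro allI impI)
  fix j M :: nat assume "j \<ge> 1"
  then show "(\<Sum>l=1..M. norm (entry U j l))
      \<le> 2 * decay_sum_bound p * a powr (1 / (2 * p - 1)) * \<kappa> powr (1 - 1 / (2 * p - 1))"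
    using assms
    by (intro sum_interpolation_le entry_row_l2) (auto simp: off_diag_decay_def)
qed

text \<open>The Jaffard algebra: its product estimate needs the decay constant of only one factor at a time.\<close>
lemma off_diag_decay_comp:
  assumes U: "off_diag_decay p U a" "row_sum_le U X" "selfadj U" "a \<ge> 0"
    and V: "off_diag_decay p V b" "row_sum_le V Y" "selfadj V" "b \<ge> 0" and p: "p > 1"
  shows "off_diag_decay p (\<lambda>u. U (K (V u))) (2 powr p * (a * Y + b * X))"
  unfolding off_diag_decay_def
proof (intro allI impI)
  fix j l :: nat assume jl: "j \<ge> 1" "l \<ge> 1"
  show "norm (entry (\<lambda>u. U (K (V u))) j l) \<le> 2 powr p * (a * Y + b * X) * decay p j l"
  proof (rule norm_entry_comp_le[OF U(3)])
    fix M
    have "(\<Sum>k=1..M. norm (entry V k l)) = (\<Sum>k=1..M. norm (entry V l k))"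
      using V(3) by (simp add: norm_entry_commute[of V _ l])
    also have "\<dots> \<le> Y" using V jl by (auto simp: row_sum_le_def)
    finally show "(\<Sum>k=1..M. norm (entry U j k) * norm (entry V k l)) \<le> 2 powr p * (a * Y + b * X) * decay p j l"
      using U V p jl by (intro sum_mult_decay_le) (auto simp: off_diag_decay_def row_sum_le_def)
  qed
qed

text \<open>The operators L k are bounded on \<open>\<H>\<close> uniformly in k, so interpolation bounds the row sums of
their matrices by a multiple of \<open>a powr \<theta>\<close>, where a is the decay constant.  With \<open>L_add\<close>, doubling k
raises a to \<open>a powr (1 + \<theta>)\<close> up to a factor.\<close>
lemma off_diag_decay_L:
  assumes p: "p > 1" and G: "off_diag_decay p (\<lambda>u. u) a0" and lam: "\<beta> > 1"
  shows "\<exists>C>0. \<forall>k. off_diag_decay p (L k) (C * \<beta> ^ k)"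
proof -
  define \<tau> where "\<tau> = decay_sum_bound p"
  define \<theta> where "\<theta> = 1 / (2 * p - 1)"
  define Q where "Q = 1 / (1 - r)"
  have \<tau>: "\<tau> \<ge> 1" using decay_sum_bound_ge_1[OF p] by (simp add: \<tau>_def)
  have th: "0 < \<theta>" "\<theta> < 1" using p by (auto simp: \<theta>_def)
  have Q: "Q \<ge> 1" using r_bounds by (simp add: Q_def)
  define X where "X a = 2 * \<tau> * a powr \<theta> * Q powr (1 - \<theta>)" for a
  define C0 where "C0 = 2 + 2 powr p * 4 * \<tau> * Q powr (1 - \<theta>)"
  show ?thesis
  proof (rule subexponential_growth[where P = "\<lambda>k. off_diag_decay p (L k)" and \<theta> = \<theta> and Q = Q and e = a0
        and \<nu> = "2 powr p * 2 * \<tau>" and D = C0])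
    show "off_diag_decay p (L 0) 0"
      by (simp add: off_diag_decay_def entry_def L_def)
    show "off_diag_decay p (L 1) a0"
      using G by (simp add: off_diag_decay_def entry_def L_def)
    show "off_diag_decay p (L (2 * k)) (C0 * a powr (1 + \<theta>))"
      if aQ: "Q \<le> a" and d: "off_diag_decay p (L k) a" for k a
    proof -
      have a: "a > 0" using aQ Q by simp
      have row: "row_sum_le (L k) (X a)"
        unfolding X_def \<tau>_def
        by (rule row_sum_interpolation[OF d p selfadj_L norm_L_le[folded Q_def] _ aQ \<theta>_def]) (use Q in simp)
      have "off_diag_decay p (L (2 * k)) ((a + a) + 2 powr p * (a * X a + a * X a))"
      proof (rule off_diag_decay_diff[OF off_diag_decay_add[OF d d refl]])
        show "off_diag_decay p (\<lambda>u. L k (K (L k u))) (2 powr p * (a * X a + a * X a))"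
          using a d row p by (intro off_diag_decay_comp selfadj_L) auto
        show "L (2 * k) u = L k u + L k u - L k (K (L k u))" for u
          using L_add[of k k u] by (simp add: mult_2)
      qed
      moreover have "(a + a) + 2 powr p * (a * X a + a * X a)
          = 2 * a + 2 powr p * 4 * \<tau> * Q powr (1 - \<theta>) * a powr (1 + \<theta>)"
        using a by (simp add: X_def powr_add algebra_simps)
      moreover have "2 * a \<le> 2 * a powr (1 + \<theta>)"
      proof -
        have "a powr 1 \<le> a powr (1 + \<theta>)" using th aQ Q by (intro powr_mono) auto
        then show ?thesis using a by simp
      qed
      ultimately show ?thesis
        by (elim off_diag_decay_mono) (simp add: C0_def distrib_right)
    qed
    show "off_diag_decay p (L (i + j)) (a + b + 2 powr p * 2 * \<tau> * a * b)"
      if d: "off_diag_decay p (L i) a" "off_diag_decay p (L j) b" and ab: "a \<ge> 0" "b \<ge> 0" for i j a b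
    proof -
      have "off_diag_decay p (L (i + j)) (a + b + 2 powr p * (a * (b * \<tau>) + b * (a * \<tau>)))"
      proof (rule off_diag_decay_diff[OF off_diag_decay_add[OF d refl] _ L_add])
        show "off_diag_decay p (\<lambda>u. L i (K (L j u))) (2 powr p * (a * (b * \<tau>) + b * (a * \<tau>)))"
          unfolding \<tau>_def using d ab p by (intro off_diag_decay_comp selfadj_L row_sum_le_of_decay) auto
      qed
      then show ?thesis by (elim off_diag_decay_mono) (simp add: algebra_simps)
    qed
    show "1 \<le> C0" using \<tau> by (simp add: C0_def)
    show "0 < 2 powr p * 2 * \<tau>" using \<tau> by simp
  qed (use Q th lam off_diag_decay_mono in auto)
qed

text \<open>T k is a difference of consecutive L, so its decay constants grow at most at the rate \<open>\<beta> > 1\<close>, which is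
at our disposal, while its norm is at most \<open>r ^ k\<close>.  By interpolation its row sums decrease at the
rate \<open>\<sigma> = \<beta> powr \<theta> * r powr (1 - \<theta>)\<close>.  As \<open>K (T (i + j)) = T i K (T j)\<close>, splitting the exponent into
halves gives the rate \<open>\<rho> = sqrt (\<beta> * \<sigma>)\<close>, and \<open>\<beta>\<close> is chosen close enough to 1 to make this less
than 1.\<close>
lemma off_diag_decay_K_T:
  assumes p: "p > 1" and G: "off_diag_decay p (\<lambda>u. u) a0"
  shows "\<exists>C>0. \<exists>\<rho>. 0 < \<rho> \<and> \<rho> < 1 \<and> (\<forall>k. off_diag_decay p (\<lambda>u. K (T k u)) (C * \<rho> ^ k))"
proof -
  define \<tau> where "\<tau> = decay_sum_bound p"
  define \<theta> where "\<theta> = 1 / (2 * p - 1)"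
  have \<tau>: "\<tau> \<ge> 1" using decay_sum_bound_ge_1[OF p] by (simp add: \<tau>_def)
  have th: "0 < \<theta>" "\<theta> < 1" using p by (auto simp: \<theta>_def)
  define \<beta> where "\<beta> = r powr (- ((1 - \<theta>) / (2 * (1 + \<theta>))))"
  have lam: "\<beta> > 1"
  proof -
    have "r powr ((1 - \<theta>) / (2 * (1 + \<theta>))) < 1"
      using r_bounds th powr_less_mono2[of "(1 - \<theta>) / (2 * (1 + \<theta>))" r 1] by simp
    then show ?thesis using r_bounds by (simp add: \<beta>_def powr_minus one_less_inverse_iff)
  qed
  obtain C1 where C1: "C1 > 0" "\<And>k. off_diag_decay p (L k) (C1 * \<beta> ^ k)"
    using off_diag_decay_L[OF p G lam] by blast
  define c where "c = max 1 (2 * C1 * \<beta>)"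
  have c: "c \<ge> 1" "c \<ge> 2 * C1 * \<beta>" by (auto simp: c_def)
  define a where "a k = c * \<beta> ^ k" for k :: nat
  have dT: "off_diag_decay p (T k) (a k)" for k
  proof -
    have "off_diag_decay p (T k) (C1 * \<beta> ^ Suc k + C1 * \<beta> ^ k)"
      by (rule off_diag_decay_diff[OF C1(2) C1(2)]) (simp add: L_def)
    moreover have "C1 * \<beta> ^ Suc k + C1 * \<beta> ^ k \<le> a k"
    proof -
      have "C1 * \<beta> ^ k \<le> C1 * \<beta> ^ Suc k"
        using C1 lam by (intro mult_left_mono power_increasing) auto
      then have "C1 * \<beta> ^ Suc k + C1 * \<beta> ^ k \<le> (2 * C1 * \<beta>) * \<beta> ^ k" by simp
      also have "\<dots> \<le> c * \<beta> ^ k" using c lam by (intro mult_right_mono) auto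
      finally show ?thesis by (simp add: a_def)
    qed
    ultimately show ?thesis by (rule off_diag_decay_mono)
  qed
  define \<sigma> where "\<sigma> = \<beta> powr \<theta> * r powr (1 - \<theta>)"
  define c' where "c' = 2 * \<tau> * c powr \<theta>"
  have sig: "\<sigma> > 0" using lam r_bounds by (simp add: \<sigma>_def)
  have c': "c' > 0" using \<tau> c by (simp add: c'_def)
  have rowT: "row_sum_le (T k) (c' * \<sigma> ^ k)" for k
  proof -
    have a_ge: "r ^ k \<le> a k"
    proof -
      have "r ^ k \<le> 1" using r_bounds by (intro power_le_one) auto
      also have "\<dots> \<le> 1 * \<beta> ^ k" using lam by simp
      also have "\<dots> \<le> a k" unfolding a_def using c lam by (intro mult_right_mono) auto
      finally show ?thesis .
    qed
    have "row_sum_le (T k) (2 * decay_sum_bound p * a k powr \<theta> * (r ^ k) powr (1 - \<theta>))"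
      by (rule row_sum_interpolation[OF dT p selfadj_T norm_T_le _ a_ge \<theta>_def]) (use r_bounds in simp)
    moreover have "2 * decay_sum_bound p * a k powr \<theta> * (r ^ k) powr (1 - \<theta>) = c' * \<sigma> ^ k"
    proof -
      have "(x ^ k) powr y = (x powr y) ^ k" if "x > 0" for x y :: real
        using that by (simp add: powr_realpow[symmetric] powr_powr mult.commute)
      then show ?thesis using lam c r_bounds
        by (simp add: a_def c'_def \<sigma>_def \<tau>_def powr_mult power_mult_distrib)
    qed
    ultimately show ?thesis by simp
  qed
  define \<rho> where "\<rho> = sqrt (\<beta> * \<sigma>)"
  have ls: "\<beta> * \<sigma> = r powr ((1 - \<theta>) / 2)"
  proof -
    have "\<beta> * \<sigma> = \<beta> powr (1 + \<theta>) * r powr (1 - \<theta>)"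
      using lam by (simp add: \<sigma>_def powr_add)
    also have "\<beta> powr (1 + \<theta>) = r powr (- ((1 - \<theta>) / 2))"
    proof -
      have "- ((1 - \<theta>) / (2 * (1 + \<theta>))) * (1 + \<theta>) = - ((1 - \<theta>) / 2)"
      proof -
        have *: "- (a / (2 * b)) * b = - (a / 2)" if "b > 0" for a b :: real
          using that by simp
        show ?thesis by (rule *) (use th in simp)
      qed
      then show ?thesis by (simp only: \<beta>_def powr_powr)
    qed
    also have "\<dots> * r powr (1 - \<theta>) = r powr ((1 - \<theta>) / 2)"
      by (simp add: powr_add[symmetric] field_simps)
    finally show ?thesis .
  qed
  have ls1: "\<beta> * \<sigma> < 1" unfolding ls using r_bounds th powr_less_mono2[of "(1 - \<theta>) / 2" r 1] by simp
  have rho: "0 < \<rho>" "\<rho> < 1" "\<rho> ^ 2 = \<beta> * \<sigma>" using ls1 lam sig by (auto simp: \<rho>_def)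
  have sig1: "\<sigma> < 1" using ls1 mult_strict_right_mono[OF lam sig] by simp
  define C where "C = 2 powr p * (2 * c * c' * \<beta>) / \<rho>"
  have C: "C > 0" using c c' lam rho by (simp add: C_def)
  have "off_diag_decay p (\<lambda>u. K (T n u)) (C * \<rho> ^ n)" for n
  proof -
    define i where "i = n div 2"
    define j where "j = n - i"
    have ij: "n = i + j" "i \<le> j" "j \<le> Suc i" "n \<le> 2 * i + 1" by (auto simp: i_def j_def)
    have "off_diag_decay p (\<lambda>u. T i (K (T j u)))
        (2 powr p * (a i * (c' * \<sigma> ^ j) + a j * (c' * \<sigma> ^ i)))"
      using c lam p by (intro off_diag_decay_comp dT rowT selfadj_T) (auto simp: a_def)
    moreover have "(\<lambda>u. T i (K (T j u))) = (\<lambda>u. K (T n u))"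
      by (simp add: ij(1) T_add K_T)
    moreover have "2 powr p * (a i * (c' * \<sigma> ^ j) + a j * (c' * \<sigma> ^ i)) \<le> C * \<rho> ^ n"
    proof -
      have "\<beta> ^ i * \<sigma> ^ j \<le> \<beta> ^ Suc i * \<sigma> ^ i"
        using lam sig sig1 ij by (intro mult_mono power_increasing power_decreasing) auto
      moreover have "\<beta> ^ j * \<sigma> ^ i \<le> \<beta> ^ Suc i * \<sigma> ^ i"
        using lam sig ij by (intro mult_right_mono power_increasing) auto
      ultimately have s: "\<beta> ^ i * \<sigma> ^ j + \<beta> ^ j * \<sigma> ^ i \<le> 2 * (\<beta> ^ Suc i * \<sigma> ^ i)" by simp
      have "\<beta> ^ Suc i * \<sigma> ^ i = \<beta> * \<rho> ^ (2 * i)"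
        by (simp add: power_mult rho(3) power_mult_distrib)
      also have "\<dots> = \<beta> * \<rho> ^ (2 * i + 1) / \<rho>" using rho by simp
      also have "\<dots> \<le> \<beta> * \<rho> ^ n / \<rho>"
        using rho lam ij by (intro divide_right_mono mult_left_mono power_decreasing) auto
      finally have "\<beta> ^ i * \<sigma> ^ j + \<beta> ^ j * \<sigma> ^ i \<le> 2 * (\<beta> * \<rho> ^ n / \<rho>)" using s by simp
      then have "(2 powr p * c * c') * (\<beta> ^ i * \<sigma> ^ j + \<beta> ^ j * \<sigma> ^ i) \<le> (2 powr p * c * c') * (2 * (\<beta> * \<rho> ^ n / \<rho>))"
        using c c' by (intro mult_left_mono) auto
      then show ?thesis by (simp add: a_def C_def algebra_simps)
    qed
    ultimately show ?thesis using off_diag_decay_mono by metis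
  qed
  with C rho show ?thesis by blast
qed

text \<open>Since \<open>K (T i u) = T i u - T (i + 1) u\<close>, summation over i \<open>\<ge>\<close> k recovers \<open>T k u\<close>: geometric decay of
a coefficient is not affected by removing one factor K.\<close>
lemma geometric_ip_descent:
  assumes rho: "0 < \<rho>" "\<rho> < 1" and D: "\<And>k. norm (ip (K (T k u)) v) \<le> D * \<rho> ^ k"
  shows "norm (ip (T k u) v) \<le> D / (1 - \<rho>) * \<rho> ^ k"
proof (rule LIMSEQ_le_const2)
  have D0: "D \<ge> 0" using order_trans[OF norm_ge_zero D[of 0]] by simp
  have "(\<lambda>N. T (k + N) u) \<longlonglongrightarrow> 0"
  proof (rule Lim_null_comparison)
    show "\<forall>\<^sub>F N in sequentially. norm (T (k + N) u) \<le> r ^ N * norm (T k u)"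
      by (simp add: add.commute[of k] T_add norm_T_le)
    show "(\<lambda>N. r ^ N * norm (T k u)) \<longlonglongrightarrow> 0"
      using r_bounds by (intro tendsto_mult_left_zero LIMSEQ_realpow_zero) auto
  qed
  then have "(\<lambda>N. T k u - T (k + N) u) \<longlonglongrightarrow> T k u - 0"
    by (intro tendsto_diff tendsto_const)
  then have "(\<lambda>N. ip (T k u - T (k + N) u) v) \<longlonglongrightarrow> ip (T k u) v"
    using tendsto_ip_left[of _ "T k u"] by simp
  then show "(\<lambda>N. norm (ip (T k u - T (k + N) u) v)) \<longlonglongrightarrow> norm (ip (T k u) v)"
    by (rule tendsto_norm)
  have "norm (ip (T k u - T (k + N) u) v) \<le> D / (1 - \<rho>) * \<rho> ^ k" for N
  proof -
    have "T k u - T (k + N) u = (\<Sum>i<N. K (T (k + i) u))"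
      by (induction N) (simp_all add: T_Suc algebra_simps)
    then have "norm (ip (T k u - T (k + N) u) v) \<le> (\<Sum>i<N. D * \<rho> ^ (k + i))"
      by (simp only: ip_sum_left) (rule sum_norm_le, rule D)
    also have "\<dots> = D * \<rho> ^ k * (\<Sum>i<N. \<rho> ^ i)"
      by (simp add: sum_distrib_left power_add mult.assoc)
    also have "\<dots> \<le> D * \<rho> ^ k * (1 / (1 - \<rho>))"
      using rho D0 by (intro mult_left_mono) (auto simp: sum_gp_strict divide_right_mono)
    finally show ?thesis by simp
  qed
  then show "\<exists>N. \<forall>n\<ge>N. norm (ip (T k u - T (k + n) u) v) \<le> D / (1 - \<rho>) * \<rho> ^ k" by blast
qed

text \<open>The weight \<open>l powr -p\<close> is \<open>decay p l 1\<close>, so applying a matrix to the coefficients of f is estimated like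
one column of a matrix product.  This handles \<open>K\<^sup>3 T\<^sup>k g = K\<^sup>2 T\<^sup>k f\<close>, and the three factors K are
removed by geometric descent.\<close>
lemma coefficient_decay_inverse:
  assumes p: "p > 1" and G: "off_diag_decay p (\<lambda>u. u) a0"
    and f: "\<And>j. j \<ge> 1 \<Longrightarrow> norm (ip f (\<phi> j)) \<le> c' * real j powr (- p)"
  shows "\<exists>C\<ge>0. \<exists>g. K g = f \<and> (\<forall>l\<ge>1. norm (ip g (\<phi> l)) \<le> C * real l powr (- p))"
proof -
  obtain C \<rho> where C: "C > 0" and rho: "0 < \<rho>" "\<rho> < 1"
    and KT: "\<And>k. off_diag_decay p (\<lambda>u. K (T k u)) (C * \<rho> ^ k)"
    using off_diag_decay_K_T[OF p G] by blast
  obtain g where g: "K g = f" using K_surj by blast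
  define \<tau> where "\<tau> = decay_sum_bound p"
  have \<tau>: "\<tau> \<ge> 1" using decay_sum_bound_ge_1[OF p] by (simp add: \<tau>_def)
  have c0: "c' \<ge> 0" using order_trans[OF norm_ge_zero f[of 1]] by simp
  define D where "D = 2 powr p * (C * (c' * \<tau>) + c' * (C * \<tau>))"
  have D0: "D \<ge> 0" using C c0 \<tau> by (simp add: D_def)
  have base: "norm (ip (K (K (K (T k g)))) (\<phi> l)) \<le> (D * real l powr (- p)) * \<rho> ^ k" if l: "l \<ge> 1" for k l
  proof -
    have sa: "ip (K (T k u)) v = ip u (K (T k v))" for u v
      by (simp only: selfadjD[OF selfadj_K] selfadjD[OF selfadj_T] K_T)
    have "ip (K (K (K (T k g)))) (\<phi> l) = ip (K (T k (K f))) (\<phi> l)"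
      by (simp only: K_T g)
    also have "\<dots> = ip (K f) (K (T k (\<phi> l)))" by (rule sa)
    also have "norm \<dots> \<le> D * real l powr (- p) * \<rho> ^ k"
    proof (rule norm_ip_K_le)
      fix M
      have "(\<Sum>j=1..M. norm (ip f (\<phi> j)) * norm (ip (\<phi> j) (K (T k (\<phi> l)))))
        = B * (\<Sum>j=1..M. norm (entry (\<lambda>u. K (T k u)) l j) * norm (ip f (\<phi> j)))"
        using B_pos by (simp add: norm_entry sa sum_distrib_left mult.commute)
      also have "(\<Sum>j=1..M. norm (entry (\<lambda>u. K (T k u)) l j) * norm (ip f (\<phi> j)))
         \<le> 2 powr p * ((C * \<rho> ^ k) * (c' * \<tau>) + c' * ((C * \<rho> ^ k) * \<tau>)) * decay p l 1"
      proof (rule sum_mult_decay_le)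
        show "(\<Sum>j=1..M. norm (entry (\<lambda>u. K (T k u)) l j)) \<le> C * \<rho> ^ k * \<tau>"
          using row_sum_le_of_decay[OF KT p, of k] C rho l by (auto simp: row_sum_le_def \<tau>_def)
        have "(\<Sum>j=1..M. norm (ip f (\<phi> j))) \<le> (\<Sum>j=1..M. c' * decay p 1 j)"
          using f by (intro sum_mono) (simp add: decay_commute[of p "Suc 0"] decay_one)
        also have "\<dots> \<le> c' * \<tau>" unfolding \<tau>_def sum_distrib_left[symmetric]
          using c0 p by (intro mult_left_mono sum_decay_le) auto
        finally show "(\<Sum>j=1..M. norm (ip f (\<phi> j))) \<le> c' * \<tau>" .
        show "0 \<le> norm (ip f (\<phi> j)) \<and> norm (ip f (\<phi> j)) \<le> c' * decay p j 1" if "j \<in> {1..M}" for j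
          using that f by (simp add: decay_one)
      qed (use KT[of k] l p C rho c0 in \<open>auto simp: off_diag_decay_def\<close>)
      also have "\<dots> = D * real l powr (- p) * \<rho> ^ k"
        using l by (simp add: D_def decay_one algebra_simps)
      finally show "(\<Sum>j=1..M. norm (ip f (\<phi> j)) * norm (ip (\<phi> j) (K (T k (\<phi> l)))))
          \<le> B * (D * real l powr (- p) * \<rho> ^ k)"
        using B_pos by simp
    qed
    finally show ?thesis .
  qed
  have "norm (ip g (\<phi> l)) \<le> D / (1 - \<rho>) ^ 3 * real l powr (- p)" if l: "l \<ge> 1" for l
  proof -
    let ?E = "D * real l powr (- p)"
    have 1: "norm (ip (K (T k (K (K g)))) (\<phi> l)) \<le> ?E * \<rho> ^ k" for k
      using base[OF l, of k] by (simp add: K_T)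
    have 2: "norm (ip (K (T k (K g))) (\<phi> l)) \<le> ?E / (1 - \<rho>) * \<rho> ^ k" for k
      using geometric_ip_descent[OF rho 1, of k] by (simp add: K_T)
    have 3: "norm (ip (K (T k g)) (\<phi> l)) \<le> ?E / (1 - \<rho>) / (1 - \<rho>) * \<rho> ^ k" for k
      using geometric_ip_descent[OF rho 2, of k] by (simp add: K_T)
    show ?thesis
      using geometric_ip_descent[OF rho 3, of 0] by (simp add: power3_eq_cube mult_ac)
  qed
  moreover have "D / (1 - \<rho>) ^ 3 \<ge> 0" using D0 rho by simp
  ultimately show ?thesis
    using g by (intro exI[of _ "D / (1 - \<rho>) ^ 3"] exI[of _ g] conjI allI impI)
qed

text \<open>With h the projection error and \<open>K g = f\<close>, \<open>\<parallel>h\<parallel>\<^sup>2 = \<langle>f, h\<rangle> = \<langle>K g, h\<rangle>\<close>.  As h is orthogonal to the first n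
frame vectors, only the coefficients of g beyond n enter.\<close>
lemma projection_error_decay:
  assumes p: "p > 1" and G: "\<forall>j\<ge>1. \<forall>l\<ge>1. norm (ip (\<phi> j) (\<phi> l)) \<le> c0 * (1 + \<bar>real j - real l\<bar>) powr (- p)"
    and f: "\<forall>j\<ge>1. norm (ip f (\<phi> j)) \<le> c' * real j powr (- p)"
  shows "\<exists>C\<ge>0. \<forall>n\<ge>1. norm (f - orth_proj ip (rec_space smul \<phi> n) f) \<le> C * real n powr (- (p - 1/2))"
proof -
  have "off_diag_decay p (\<lambda>u. u) (c0 / B)"
    using G B_pos by (simp add: off_diag_decay_def norm_entry decay_def divide_right_mono norm_ip_commute)
  from coefficient_decay_inverse[OF p this] f
  obtain C g where C: "C \<ge> 0" and g: "K g = f"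
    and gC: "\<And>l. l \<ge> 1 \<Longrightarrow> norm (ip g (\<phi> l)) \<le> C * real l powr (- p)"
    by blast
  define E where "E = C / sqrt (B * (2 * p - 1))"
  have "norm (f - orth_proj ip (rec_space smul \<phi> n) f) \<le> E * real n powr (- (p - 1/2))" if n: "n \<ge> 1" for n
  proof -
    define h where "h = f - orth_proj ip (rec_space smul \<phi> n) f"
    have orth: "ip h v = 0" if "v \<in> rec_space smul \<phi> n" for v
      using that unfolding h_def rec_space_def by (intro orth_proj_orth) auto
    have h_phi: "ip (\<phi> j) h = 0" if "j \<in> {1..n}" for j
    proof -
      have "\<phi> j \<in> rec_space smul \<phi> n" unfolding rec_space_def using that by (intro span_base) auto
      from orth[OF this] show ?thesis using ip_commute[of "\<phi> j" h] by simp
    qed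
    have "ip f h = ip h h"
    proof -
      have "orth_proj ip (rec_space smul \<phi> n) f \<in> rec_space smul \<phi> n"
        unfolding rec_space_def by (intro orth_proj_in) auto
      from orth[OF this] have "ip (orth_proj ip (rec_space smul \<phi> n) f) h = 0"
        using ip_commute[of "orth_proj ip (rec_space smul \<phi> n) f" h] by simp
      then show ?thesis by (simp add: h_def ip_diff_left)
    qed
    then have hh: "(norm h)\<^sup>2 = norm (ip (K g) h)"
      by (simp add: g ip_self norm_power)
    let ?R = "E * real n powr (- (p - 1/2)) * norm h"
    have "norm (ip (K g) h) \<le> ?R"
    proof (rule norm_ip_K_le)
      fix M
      have "(\<Sum>j=1..M. norm (ip g (\<phi> j)) * norm (ip (\<phi> j) h)) = (\<Sum>j\<in>{n<..M}. norm (ip g (\<phi> j)) * norm (ip (\<phi> j) h))"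
        using h_phi n by (intro sum.mono_neutral_right) auto
      also have "\<dots> \<le> B * ?R"
      proof (rule power2_le_imp_le)
        have "(\<Sum>j\<in>{n<..M}. norm (ip g (\<phi> j)) * norm (ip (\<phi> j) h))\<^sup>2
          \<le> (\<Sum>j\<in>{n<..M}. (norm (ip g (\<phi> j)))\<^sup>2) * (\<Sum>j\<in>{n<..M}. (norm (ip h (\<phi> j)))\<^sup>2)"
          using Cauchy_Schwarz_ineq_sum[of "\<lambda>j. norm (ip g (\<phi> j))" "\<lambda>j. norm (ip (\<phi> j) h)"]
          by (simp add: norm_ip_commute[of h])
        also have "\<dots> \<le> (C\<^sup>2 * (real n powr (1 - 2 * p) / (2 * p - 1))) * (B * (norm h)\<^sup>2)"
        proof (intro mult_mono)
          have "(\<Sum>j\<in>{n<..M}. (norm (ip g (\<phi> j)))\<^sup>2) \<le> (\<Sum>j\<in>{n<..M}. C\<^sup>2 * real j powr (- (2 * p)))"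
          proof (rule sum_mono)
            fix j assume j: "j \<in> {n<..M}"
            then have "(norm (ip g (\<phi> j)))\<^sup>2 \<le> (C * real j powr (- p))\<^sup>2"
              using n by (intro power_mono gC) auto
            also have "\<dots> = C\<^sup>2 * real j powr (- (2 * p))"
              by (simp add: power2_eq_square powr_add[symmetric])
            finally show "(norm (ip g (\<phi> j)))\<^sup>2 \<le> C\<^sup>2 * real j powr (- (2 * p))" .
          qed
          also have "\<dots> \<le> C\<^sup>2 * (real n powr (1 - 2 * p) / (2 * p - 1))"
            unfolding sum_distrib_left[symmetric]
            using p n by (intro mult_left_mono sum_powr_tail_le) auto
          finally show "(\<Sum>j\<in>{n<..M}. (norm (ip g (\<phi> j)))\<^sup>2) \<le> C\<^sup>2 * (real n powr (1 - 2 * p) / (2 * p - 1))" .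
          show "(\<Sum>j\<in>{n<..M}. (norm (ip h (\<phi> j)))\<^sup>2) \<le> B * (norm h)\<^sup>2"
            using n by (intro bessel) auto
        qed (use p in \<open>auto intro!: sum_nonneg\<close>)
        also have "\<dots> = (B * ?R)\<^sup>2"
        proof -
          have "(real n powr (- (p - 1/2)))\<^sup>2 = real n powr (1 - 2 * p)"
            by (simp add: power2_eq_square powr_add[symmetric])
          moreover have "E\<^sup>2 = C\<^sup>2 / (B * (2 * p - 1))"
            using B_pos p by (simp add: E_def power_divide)
          ultimately show ?thesis using B_pos p
            by (simp add: power_mult_distrib power2_eq_square[of B])
        qed
        finally show "(\<Sum>j\<in>{n<..M}. norm (ip g (\<phi> j)) * norm (ip (\<phi> j) h))\<^sup>2 \<le> (B * ?R)\<^sup>2" .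
      qed (use C B_pos p in \<open>auto simp: E_def\<close>)
      finally show "(\<Sum>j=1..M. norm (ip g (\<phi> j)) * norm (ip (\<phi> j) h)) \<le> B * ?R" .
    qed
    then have "norm h * norm h \<le> E * real n powr (- (p - 1/2)) * norm h"
      using hh by (simp add: power2_eq_square)
    moreover have "0 \<le> E * real n powr (- (p - 1/2))" using C B_pos p by (simp add: E_def)
    ultimately have "norm h \<le> E * real n powr (- (p - 1/2))"
      by (cases "h = 0") (simp_all only: mult_le_cancel_right, auto)
    then show ?thesis by (simp add: h_def)
  qed
  moreover have "E \<ge> 0" using C B_pos p by (simp add: E_def)
  ultimately show ?thesis by blast
qed

end

section \<open>The smallest eigenvalue of the Gram matrix\<close>

lemma nonneg_parabola_vertex:
  fixes D C :: real
  assumes "\<And>x. 0 \<le> 2 * x * D + x\<^sup>2 * C" "D \<ge> 0"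
  shows "D = 0"
proof (rule ccontr)
  assume "D \<noteq> 0"
  then have D: "D > 0" using assms by simp
  define t where "t = D / (\<bar>C\<bar> + 1)"
  have t: "t > 0" using D by (simp add: t_def)
  have "0 \<le> 2 * (- t) * D + (- t)\<^sup>2 * C" by (rule assms)
  then have "t * (2 * D) \<le> t * (t * C)" by (simp add: power2_eq_square algebra_simps)
  then have "2 * D \<le> t * C" using t by simp
  also have "\<dots> \<le> t * (\<bar>C\<bar> + 1)" using t by (intro mult_left_mono) auto
  also have "\<dots> = D" by (simp add: t_def)
  finally show False using D by simp
qed

lemma compact_cube:
  "compact (Pi\<^sub>E UNIV (\<lambda>i. if i < n then cball 0 1 else {0}) :: (nat \<Rightarrow> 'a::{real_normed_vector, heine_borel}) set)"
proof -
  have "compactin (product_topology (\<lambda>_. euclidean) UNIV)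
      (Pi\<^sub>E UNIV (\<lambda>i. if i < n then cball 0 1 else {0}) :: (nat \<Rightarrow> 'a) set)"
    unfolding compactin_PiE by auto
  then show ?thesis by (simp add: euclidean_product_topology)
qed

context separable_hilbert_space
begin

text \<open>The coefficients are conjugated so that the Gram matrix \<open>[\<langle>e\<^sub>j, e\<^sub>l\<rangle>]\<close> itself, and not its transpose, acts
on the coefficient vector in \<open>gram_mult_vec\<close>.  Coefficients are indexed from 0, vectors from 1.\<close>
definition comb :: "(nat \<Rightarrow> 'h) \<Rightarrow> nat \<Rightarrow> (nat \<Rightarrow> 'k) \<Rightarrow> 'h" where
  "comb e n c = (\<Sum>l<n. smul (sconj (c l)) (e (Suc l)))"

definition sqsum :: "nat \<Rightarrow> (nat \<Rightarrow> 'k) \<Rightarrow> real" where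
  "sqsum n c = (\<Sum>l<n. (norm (c l))\<^sup>2)"

lemma sqsum_nonneg: "sqsum n c \<ge> 0"
  by (simp add: sqsum_def sum_nonneg)

lemma sqsum_eq_0_iff: "sqsum n c = 0 \<longleftrightarrow> (\<forall>l<n. c l = 0)"
  by (auto simp: sqsum_def sum_nonneg_eq_0_iff)

lemma comb_add: "comb e n (\<lambda>l. c l + d l) = comb e n c + comb e n d"
  by (simp add: comb_def sconj_add scale_left_distrib sum.distrib)

lemma comb_scaleR: "comb e n (\<lambda>l. of_real x * c l) = x *\<^sub>R comb e n c"
  by (simp add: comb_def sconj_mult scaleR_eq_scale scale_sum_right)

lemma continuous_on_smul: "continuous_on UNIV (\<lambda>a. smul (sconj a) x)"
proof (rule linear_continuous_on, rule bounded_linear_intro)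
  show "norm (smul (sconj a) x) \<le> norm a * norm x" for a
    by (simp add: norm_smul)
  show "smul (sconj (k *\<^sub>R a)) x = k *\<^sub>R smul (sconj a) x" for k a
    by (simp add: scaleR_conv_of_real sconj_mult scaleR_eq_scale)
qed (simp add: sconj_add scale_left_distrib)

lemma continuous_on_comb: "continuous_on UNIV (comb e n)"
  unfolding comb_def
  by (intro continuous_on_sum continuous_on_compose2[OF continuous_on_smul]) auto

lemma continuous_on_sqsum: "continuous_on UNIV (sqsum n)"
  unfolding sqsum_def by (intro continuous_intros continuous_on_product_coordinates)

lemma ip_comb_left: "ip (comb e n d) u = (\<Sum>l<n. sconj (d l) * ip (e (Suc l)) u)"
  by (simp add: comb_def ip_sum_left ip_scale_left)

lemma gram_mult_vec:
  "gram_mat ip e n *\<^sub>v vec n c = vec n (\<lambda>j. ip (e (Suc j)) (comb e n c))"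
  by (rule eq_vecI)
     (auto simp: gram_mat_def scalar_prod_def comb_def ip_sum_right ip_scale_right sconj_sconj
        mult.commute lessThan_atLeast0 intro!: sum.cong)

text \<open>The Rayleigh quotient attains its minimum \<open>\<rho>\<close> on the compact unit sphere at some c.  Let d be the
residual \<open>G c - \<rho> c\<close>.  Along the line \<open>c + x d\<close> the nonnegative form
\<open>\<parallel>comb\<parallel>\<^sup>2 - \<rho> * sqsum\<close> vanishes at \<open>x = 0\<close> and has slope \<open>2 * sqsum d\<close>, so d vanishes.\<close>
lemma rayleigh_minimum_is_eigenvalue:
  assumes "n \<ge> 1"
  shows "\<exists>\<rho>. eigenvalue (gram_mat ip e n) (of_real \<rho>) \<and> (\<forall>c. \<rho> * sqsum n c \<le> (norm (comb e n c))\<^sup>2)"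
proof -
  define X where "X = (Pi\<^sub>E UNIV (\<lambda>i. if i < n then cball 0 1 else {0}) :: (nat \<Rightarrow> 'k) set) \<inter> {c. sqsum n c = 1}"
  have "closed {c. sqsum n c = 1}"
    using continuous_closed_preimage_constant[OF continuous_on_sqsum closed_UNIV, of n 1] by simp
  then have "compact X" unfolding X_def using compact_cube by blast
  moreover have "(\<lambda>l. if l = 0 then 1 else 0) \<in> X"
    using assms by (auto simp: X_def sqsum_def PiE_UNIV_domain if_distrib[of norm] if_distrib[of "\<lambda>x. x\<^sup>2"] cong: if_cong)
  moreover have "continuous_on X (\<lambda>c. (norm (comb e n c))\<^sup>2)"
    by (intro continuous_intros continuous_on_subset[OF continuous_on_comb]) auto
  ultimately obtain c where c: "c \<in> X" and min: "\<And>d. d \<in> X \<Longrightarrow> (norm (comb e n c))\<^sup>2 \<le> (norm (comb e n d))\<^sup>2"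
    using continuous_attains_inf[of X "\<lambda>c. (norm (comb e n c))\<^sup>2"] by blast
  define \<rho> where "\<rho> = (norm (comb e n c))\<^sup>2"
  have c1: "sqsum n c = 1" using c by (simp add: X_def)
  have rayleigh: "\<rho> * sqsum n d \<le> (norm (comb e n d))\<^sup>2" for d
  proof (cases "sqsum n d = 0")
    case False
    then have N: "sqsum n d > 0" using sqsum_nonneg[of n d] by simp
    define x where "x = 1 / sqrt (sqsum n d)"
    have x: "x > 0" "x\<^sup>2 = 1 / sqsum n d" using N by (auto simp: x_def power_divide)
    define d' where "d' l = (if l < n then of_real x * d l else 0)" for l
    have "sqsum n d' = x\<^sup>2 * sqsum n d"
      by (simp add: sqsum_def d'_def norm_mult power_mult_distrib sum_distrib_left)
    then have s1: "sqsum n d' = 1" using x N by simp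
    have "norm (d' l) \<le> 1" if "l < n" for l
    proof -
      have "(norm (d' l))\<^sup>2 \<le> sqsum n d'"
        unfolding sqsum_def using that by (intro member_le_sum) auto
      then have "(norm (d' l))\<^sup>2 \<le> 1\<^sup>2" using s1 by simp
      then show ?thesis by (rule power2_le_imp_le) simp
    qed
    with s1 have "d' \<in> X" by (auto simp: X_def PiE_UNIV_domain d'_def)
    then have "\<rho> \<le> (norm (comb e n d'))\<^sup>2" using min by (simp add: \<rho>_def)
    also have "comb e n d' = comb e n (\<lambda>l. of_real x * d l)" by (simp add: comb_def d'_def)
    also have "(norm \<dots>)\<^sup>2 = (norm (comb e n d))\<^sup>2 / sqsum n d"
      by (simp add: comb_scaleR power_mult_distrib x)
    finally show ?thesis using N by (simp add: field_simps)
  qed simp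
  define d where "d j = ip (e (Suc j)) (comb e n c) - of_real \<rho> * c j" for j
  have ip_e: "ip (e (Suc j)) (comb e n c) = d j + of_real \<rho> * c j" for j
    by (simp add: d_def)
  define S where "S = (\<Sum>l<n. sconj (d l) * c l)"
  have dc: "ip (comb e n d) (comb e n c) = of_real (sqsum n d) + of_real \<rho> * S"
    by (simp add: ip_comb_left ip_e distrib_left sum.distrib S_def sum_distrib_left sqsum_def
        mult_sconj_eq[symmetric] mult_ac del: of_real_power)
  have cd: "ip (comb e n c) (comb e n d) = of_real (sqsum n d) + of_real \<rho> * sconj S"
    using dc ip_commute[of "comb e n c" "comb e n d"] by (simp add: sconj_add sconj_mult)
  have "sqsum n d = 0"
  proof (rule nonneg_parabola_vertex)
    fix x :: real
    let ?Q = "(norm (comb e n d))\<^sup>2 - \<rho> * sqsum n d"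
    let ?w = "\<lambda>l. c l + of_real x * d l"
    have "ip (comb e n ?w) (comb e n ?w) = of_real \<rho> + of_real x * (2 * of_real (sqsum n d) + of_real \<rho> * (S + sconj S))
        + of_real (x\<^sup>2) * of_real ((norm (comb e n d))\<^sup>2)"
    proof -
      have "ip (comb e n c) (comb e n c) = of_real \<rho>" by (simp only: ip_self \<rho>_def)
      then show ?thesis
        unfolding comb_add comb_scaleR ip_add_left ip_add_right ip_scaleR_left ip_scaleR_right dc cd ip_self[of "comb e n d"]
        by (simp add: algebra_simps power2_eq_square)
    qed
    moreover have "of_real (sqsum n ?w) = (1 :: 'k) + of_real x * (S + sconj S) + of_real (x\<^sup>2) * of_real (sqsum n d)"
    proof -
      have "of_real (sqsum n ?w) = (\<Sum>l<n. ?w l * sconj (?w l))"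
        by (simp add: sqsum_def mult_sconj_eq)
      also have "\<dots> = (\<Sum>l<n. c l * sconj (c l) + of_real x * (sconj (d l) * c l + d l * sconj (c l))
          + of_real (x\<^sup>2) * (d l * sconj (d l)))"
        by (intro sum.cong refl) (simp add: sconj_add sconj_mult algebra_simps power2_eq_square)
      also have "\<dots> = of_real (sqsum n c) + of_real x * (S + sconj S) + of_real (x\<^sup>2) * of_real (sqsum n d)"
        by (simp add: sum.distrib sum_distrib_left[symmetric] S_def sconj_sum sconj_mult sconj_sconj mult_sconj_eq sqsum_def)
      finally show ?thesis by (simp add: c1)
    qed
    ultimately have "(of_real ((norm (comb e n ?w))\<^sup>2) :: 'k) - of_real \<rho> * of_real (sqsum n ?w)
        = 2 * of_real x * of_real (sqsum n d) + of_real (x\<^sup>2) * (of_real ((norm (comb e n d))\<^sup>2) - of_real \<rho> * of_real (sqsum n d))"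
      unfolding ip_self by (simp add: algebra_simps)
    then have "(of_real ((norm (comb e n ?w))\<^sup>2 - \<rho> * sqsum n ?w) :: 'k) = of_real (2 * x * sqsum n d + x\<^sup>2 * ?Q)"
      by simp
    then have "(norm (comb e n ?w))\<^sup>2 - \<rho> * sqsum n ?w = 2 * x * sqsum n d + x\<^sup>2 * ?Q"
      by (simp only: of_real_eq_iff)
    then show "0 \<le> 2 * x * sqsum n d + x\<^sup>2 * ?Q" using rayleigh[of ?w] by simp
  qed (rule sqsum_nonneg)
  then have d0: "d j = 0" if "j < n" for j using that by (simp add: sqsum_eq_0_iff)
  have "gram_mat ip e n *\<^sub>v vec n c = of_real \<rho> \<cdot>\<^sub>v vec n c"
    unfolding gram_mult_vec by (rule eq_vecI) (auto simp: ip_e d0)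
  moreover have "vec n c \<noteq> 0\<^sub>v n"
  proof
    assume "vec n c = 0\<^sub>v n"
    then have "c l = 0" if "l < n" for l using that by (metis index_vec index_zero_vec(1))
    then have "sqsum n c = 0" by (simp add: sqsum_eq_0_iff)
    with c1 show False by simp
  qed
  ultimately have "eigenvalue (gram_mat ip e n) (of_real \<rho>)"
    unfolding eigenvalue_def eigenvector_def by (intro exI[of _ "vec n c"]) (auto simp: gram_mat_def)
  with rayleigh show ?thesis by blast
qed

lemma eigenvalue_gram_pos:
  assumes "invertible_mat (gram_mat ip e n)" "eigenvalue (gram_mat ip e n) (of_real \<mu>)"
  shows "\<mu> > 0"
proof -
  let ?M = "gram_mat ip e n"
  have M: "?M \<in> carrier_mat n n" by (simp add: gram_mat_def)
  obtain v where v: "v \<in> carrier_vec n" "v \<noteq> 0\<^sub>v n" "?M *\<^sub>v v = of_real \<mu> \<cdot>\<^sub>v v"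
    using assms(2) M unfolding eigenvalue_def eigenvector_def by auto
  define c where "c l = v $ l" for l
  have vc: "v = vec n c" using v(1) by (intro eq_vecI) (auto simp: c_def)
  have *: "ip (e (Suc j)) (comb e n c) = of_real \<mu> * c j" if "j < n" for j
  proof -
    have "(?M *\<^sub>v v) $ j = ip (e (Suc j)) (comb e n c)" using that by (simp add: vc gram_mult_vec)
    moreover have "(of_real \<mu> \<cdot>\<^sub>v v) $ j = of_real \<mu> * c j" using that v(1) by (simp add: c_def)
    ultimately show ?thesis using v(3) by simp
  qed
  have "ip (comb e n c) (comb e n c) = of_real (\<mu> * sqsum n c)"
    unfolding ip_comb_left by (simp add: * sqsum_def sum_distrib_left mult_sconj_eq[symmetric] mult_ac del: of_real_power)
  then have eq: "(norm (comb e n c))\<^sup>2 = \<mu> * sqsum n c" by (rule norm_sq_eq_of_ip)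
  have "sqsum n c \<noteq> 0"
  proof
    assume "sqsum n c = 0"
    then have "v = 0\<^sub>v n" by (intro eq_vecI) (auto simp: vc sqsum_eq_0_iff)
    with v show False by simp
  qed
  then have N: "sqsum n c > 0" using sqsum_nonneg[of n c] by simp
  have "\<mu> \<noteq> 0"
  proof
    assume "\<mu> = 0"
    then have Mv: "?M *\<^sub>v v = 0\<^sub>v n" using v by auto
    obtain B where B: "?M * B = 1\<^sub>m n" "B * ?M = 1\<^sub>m (dim_row B)"
      using assms(1) M unfolding invertible_mat_def inverts_mat_def by auto
    have "dim_col (?M * B) = n" "dim_col (B * ?M) = dim_row B" using B by simp_all
    then have Bc: "B \<in> carrier_mat n n" using M by auto
    have "v = (B * ?M) *\<^sub>v v" using B Bc v by simp
    also have "\<dots> = B *\<^sub>v 0\<^sub>v n" using assoc_mult_mat_vec[OF Bc M v(1)] Mv by simp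
    also have "\<dots> = 0\<^sub>v n" using Bc by auto
    finally show False using v by simp
  qed
  moreover have "0 \<le> \<mu> * sqsum n c" using eq by (metis zero_le_power2)
  ultimately show ?thesis using N by (simp add: zero_le_mult_iff)
qed

text \<open>The set in the definition of \<open>lambda_min\<close> is finite because its elements are roots of the
characteristic polynomial, and it contains the minimum of the Rayleigh quotient.\<close>
lemma lambda_min_gram:
  assumes "n \<ge> 1" "invertible_mat (gram_mat ip e n)"
  shows "lambda_min (gram_mat ip e n) > 0"
    and "lambda_min (gram_mat ip e n) * sqsum n c \<le> (norm (comb e n c))\<^sup>2"
proof -
  let ?M = "gram_mat ip e n"
  let ?E = "{\<mu>::real. eigenvalue ?M (of_real \<mu>)}"
  have M: "?M \<in> carrier_mat n n" by (simp add: gram_mat_def)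
  have "char_poly ?M \<noteq> 0" using degree_monic_char_poly[OF M] assms(1) by auto
  then have "finite {z. poly (char_poly ?M) z = 0}" by (rule poly_roots_finite)
  then have "finite (of_real -` {z. poly (char_poly ?M) z = 0} :: real set)"
    by (rule finite_vimageI) (simp add: inj_of_real)
  then have fin: "finite ?E" by (simp add: eigenvalue_root_char_poly[OF M] vimage_def)
  obtain \<rho> where \<rho>: "eigenvalue ?M (of_real \<rho>)" and min: "\<And>c. \<rho> * sqsum n c \<le> (norm (comb e n c))\<^sup>2"
    using rayleigh_minimum_is_eigenvalue[OF assms(1)] by blast
  have "lambda_min ?M \<in> ?E" unfolding lambda_min_def using fin \<rho> by (intro Min_in) auto
  then show "lambda_min ?M > 0" using eigenvalue_gram_pos[OF assms(2)] by simp
  have "lambda_min ?M \<le> \<rho>" unfolding lambda_min_def using fin \<rho> by (intro Min_le) auto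
  then show "lambda_min ?M * sqsum n c \<le> (norm (comb e n c))\<^sup>2"
    using min[of c] sqsum_nonneg[of n c] by (meson mult_right_mono order_trans)
qed

lemma rec_space_comb:
  assumes "g \<in> rec_space smul e n"
  shows "\<exists>c. g = comb e n c"
proof -
  have "span (e ` {1..n}) \<subseteq> range (comb e n)"
  proof (rule span_minimal)
    show "e ` {1..n} \<subseteq> range (comb e n)"
    proof safe
      fix j assume j: "j \<in> {1..n}"
      then have "e j = comb e n (\<lambda>l. if l = j - 1 then 1 else 0)"
        by (simp add: comb_def if_distrib[of sconj] if_distrib[of "\<lambda>a. smul a x" for x] cong: if_cong)
         (use j in auto)
      then show "e j \<in> range (comb e n)" by blast
    qed
    show "subspace (range (comb e n))"
    proof (rule subspaceI)
      have "comb e n (\<lambda>_. 0) = 0" by (simp add: comb_def)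
      then show "0 \<in> range (comb e n)" by (metis rangeI)
      show "x + y \<in> range (comb e n)" if "x \<in> range (comb e n)" "y \<in> range (comb e n)" for x y
        using that comb_add[of e n, symmetric] by auto
      show "smul a x \<in> range (comb e n)" if x: "x \<in> range (comb e n)" for a x
      proof -
        obtain c where "x = comb e n c" using x by blast
        then have "smul a x = comb e n (\<lambda>l. sconj a * c l)"
          by (simp add: comb_def scale_sum_right sconj_mult sconj_sconj)
        then show ?thesis by blast
      qed
    qed
  qed
  with assms show ?thesis by (auto simp: rec_space_def)
qed

end

section \<open>Reconstruction from finitely many frame coefficients\<close>

context hilbert_frame
begin

text \<open>From here on the frame \<open>\<phi>\<close> of the locale is the sampling frame, and e spans the reconstruction
space.  With \<open>N = m - n\<close>, every \<open>j > m\<close> has distance greater than N from every \<open>l \<le> n\<close>, so the part of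
the frame sum beyond m is at most
\<open>c1\<^sup>2 * n * N powr (1 - 2 * s) / (2 * s - 1)\<close> times the sum of the squared coefficients of g,
and N is chosen to make this at most \<open>A/2 * \<parallel>g\<parallel>\<^sup>2\<close>.\<close>
lemma truncated_coercivity:
  assumes n: "n \<ge> 1" and inv: "invertible_mat (gram_mat ip e n)" and c1: "c1 > 0" and s: "s > 1/2"
    and cross: "\<And>j l. j \<ge> 1 \<Longrightarrow> l \<ge> 1 \<Longrightarrow> norm (ip (\<phi> j) (e l)) \<le> c1 * (1 + \<bar>real j - real l\<bar>) powr (- s)"
    and m: "m = n + nat \<lceil>(2 * c1\<^sup>2 * real n / (A * (2 * s - 1) * lambda_min (gram_mat ip e n))) powr (1 / (2 * s - 1))\<rceil>"
    and g: "g \<in> rec_space smul e n"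
  shows "A / 2 * (norm g)\<^sup>2 \<le> (\<Sum>j=1..m. (norm (ip g (\<phi> j)))\<^sup>2)"
proof -
  define \<mu> where "\<mu> = lambda_min (gram_mat ip e n)"
  have mu: "\<mu> > 0" using lambda_min_gram(1)[OF n inv] by (simp add: \<mu>_def)
  define z where "z = 2 * c1\<^sup>2 * real n / (A * (2 * s - 1) * \<mu>)"
  have z: "z > 0" using n c1 s mu A_pos by (simp add: z_def)
  define N where "N = nat \<lceil>z powr (1 / (2 * s - 1))\<rceil>"
  have mN: "m = n + N" by (simp add: m N_def z_def \<mu>_def)
  have N_ge: "z powr (1 / (2 * s - 1)) \<le> real N" unfolding N_def by linarith
  have "z powr (1 / (2 * s - 1)) > 0" using z by simp
  then have N1: "N \<ge> 1" using N_ge by linarith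
  have N_pow: "real N powr (1 - 2 * s) \<le> 1 / z"
  proof -
    have "z = (z powr (1 / (2 * s - 1))) powr (2 * s - 1)" using z s by (simp add: powr_powr)
    also have "\<dots> \<le> real N powr (2 * s - 1)" using N_ge s by (intro powr_mono2) auto
    finally have "z \<le> real N powr (2 * s - 1)" .
    then have "inverse (real N powr (2 * s - 1)) \<le> inverse z" using z by (intro le_imp_inverse_le)
    then show ?thesis using powr_minus[of "real N" "2 * s - 1"] by (simp add: inverse_eq_divide)
  qed
  obtain c where gc: "g = comb e n c" using rec_space_comb[OF g] by blast
  have c_le: "\<mu> * sqsum n c \<le> (norm g)\<^sup>2" using lambda_min_gram(2)[OF n inv, of c] by (simp add: gc \<mu>_def)
  have coef: "(norm (ip g (\<phi> j)))\<^sup>2 \<le> sqsum n c * (\<Sum>l<n. c1\<^sup>2 * decay (2 * s) (Suc l) j)" if j: "j \<ge> 1" for j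
  proof -
    have "norm (ip g (\<phi> j)) \<le> (\<Sum>l<n. norm (c l) * norm (ip (e (Suc l)) (\<phi> j)))"
      unfolding gc ip_comb_left by (rule sum_norm_le) (simp add: norm_mult)
    then have "(norm (ip g (\<phi> j)))\<^sup>2 \<le> (\<Sum>l<n. norm (c l) * norm (ip (e (Suc l)) (\<phi> j)))\<^sup>2"
      by (intro power_mono) auto
    also have "\<dots> \<le> sqsum n c * (\<Sum>l<n. (norm (ip (e (Suc l)) (\<phi> j)))\<^sup>2)"
      unfolding sqsum_def by (rule Cauchy_Schwarz_ineq_sum)
    also have "\<dots> \<le> sqsum n c * (\<Sum>l<n. c1\<^sup>2 * decay (2 * s) (Suc l) j)"
    proof (intro mult_left_mono sum_mono sqsum_nonneg)
      fix l
      have "norm (ip (e (Suc l)) (\<phi> j)) \<le> c1 * decay s (Suc l) j"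
        using cross[OF j, of "Suc l"]
        unfolding norm_ip_commute[of "e (Suc l)"] decay_def abs_minus_commute[of "real (Suc l)"]
        by simp
      then have "(norm (ip (e (Suc l)) (\<phi> j)))\<^sup>2 \<le> (c1 * decay s (Suc l) j)\<^sup>2" by (intro power_mono) auto
      then show "(norm (ip (e (Suc l)) (\<phi> j)))\<^sup>2 \<le> c1\<^sup>2 * decay (2 * s) (Suc l) j"
        by (simp add: power_mult_distrib decay_power2)
    qed
    finally show ?thesis .
  qed
  have tail: "(\<Sum>j\<in>{m<..M}. (norm (ip g (\<phi> j)))\<^sup>2) \<le> A / 2 * (norm g)\<^sup>2" for M
  proof -
    have "(\<Sum>j\<in>{m<..M}. (norm (ip g (\<phi> j)))\<^sup>2) \<le> (\<Sum>j\<in>{m<..M}. sqsum n c * (\<Sum>l<n. c1\<^sup>2 * decay (2 * s) (Suc l) j))"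
      by (intro sum_mono coef) auto
    also have "\<dots> = sqsum n c * (c1\<^sup>2 * (\<Sum>l<n. \<Sum>j\<in>{m<..M}. decay (2 * s) (Suc l) j))"
      by (simp add: sum_distrib_left[symmetric] sum.swap[of _ "{m<..M}"])
    also have "\<dots> \<le> sqsum n c * (c1\<^sup>2 * (\<Sum>l<n. real N powr (1 - 2 * s) / (2 * s - 1)))"
      using s N1 by (intro mult_left_mono sum_mono sum_decay_above_le sqsum_nonneg) (auto simp: mN)
    also have "\<dots> = sqsum n c * (c1\<^sup>2 * (real n * (real N powr (1 - 2 * s) / (2 * s - 1))))" by simp
    also have "\<dots> \<le> sqsum n c * (c1\<^sup>2 * (real n * (1 / z / (2 * s - 1))))"
      using s by (intro mult_left_mono divide_right_mono N_pow sqsum_nonneg) auto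
    also have "c1\<^sup>2 * (real n * (1 / z / (2 * s - 1))) = A / 2 * \<mu>"
      using n c1 s mu A_pos by (simp add: z_def field_simps)
    also have "sqsum n c * (A / 2 * \<mu>) = A / 2 * (\<mu> * sqsum n c)" by simp
    also have "\<dots> \<le> A / 2 * (norm g)\<^sup>2" using c_le A_pos by (intro mult_left_mono) auto
    finally show ?thesis .
  qed
  have "A * (norm g)\<^sup>2 \<le> (\<Sum>j=1..m. (norm (ip g (\<phi> j)))\<^sup>2) + A / 2 * (norm g)\<^sup>2"
  proof (rule frame_lower)
    fix M
    have "(\<Sum>j=1..M. (norm (ip g (\<phi> j)))\<^sup>2) \<le> (\<Sum>j\<in>{1..m} \<union> {m<..M}. (norm (ip g (\<phi> j)))\<^sup>2)"
      by (intro sum_mono2) auto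
    also have "\<dots> = (\<Sum>j=1..m. (norm (ip g (\<phi> j)))\<^sup>2) + (\<Sum>j\<in>{m<..M}. (norm (ip g (\<phi> j)))\<^sup>2)"
      by (intro sum.union_disjoint) auto
    also have "\<dots> \<le> (\<Sum>j=1..m. (norm (ip g (\<phi> j)))\<^sup>2) + A / 2 * (norm g)\<^sup>2" using tail by simp
    finally show "(\<Sum>j=1..M. (norm (ip g (\<phi> j)))\<^sup>2) \<le> \<dots>" .
  qed
  then show ?thesis by simp
qed

lemma partial_frame_op_add: "partial_frame_op smul ip \<phi> m (u + v) = partial_frame_op smul ip \<phi> m u + partial_frame_op smul ip \<phi> m v"
  by (rule selfadj_add[OF selfadj_partial_frame_op])

lemma linear_W_op: "Vector_Spaces.linear smul smul (W_op smul ip \<phi> e n m)"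
proof (unfold_locales)
  show "W_op smul ip \<phi> e n m (x + y) = W_op smul ip \<phi> e n m x + W_op smul ip \<phi> e n m y" for x y
    by (simp add: W_op_def rec_space_def partial_frame_op_add orth_proj_add)
  show "W_op smul ip \<phi> e n m (smul a x) = smul a (W_op smul ip \<phi> e n m x)" for a x
  proof -
    have "partial_frame_op smul ip \<phi> m (smul a x) = smul a (partial_frame_op smul ip \<phi> m x)"
      by (simp add: partial_frame_op_def ip_scale_left scale_sum_right)
    then show ?thesis by (simp add: W_op_def rec_space_def orth_proj_scale)
  qed
qed

lemma W_op_in: "W_op smul ip \<phi> e n m g \<in> rec_space smul e n"
  unfolding W_op_def rec_space_def by (intro orth_proj_in) auto

lemma W_op_lower:
  assumes g: "g \<in> rec_space smul e n"
    and coercive: "a * (norm g)\<^sup>2 \<le> (\<Sum>j=1..m. (norm (ip g (\<phi> j)))\<^sup>2)"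
  shows "a * norm g \<le> norm (W_op smul ip \<phi> e n m g)"
proof (cases "g = 0")
  case False
  have "ip (W_op smul ip \<phi> e n m g) g = of_real (\<Sum>j=1..m. (norm (ip g (\<phi> j)))\<^sup>2)"
    using g unfolding W_op_def rec_space_def
    by (subst ip_orth_proj) (auto simp: ip_partial_frame_op_self)
  then have "norm (ip (W_op smul ip \<phi> e n m g) g) = (\<Sum>j=1..m. (norm (ip g (\<phi> j)))\<^sup>2)"
    by (simp only: norm_of_real) (simp add: sum_nonneg)
  then have "a * norm g * norm g \<le> norm (W_op smul ip \<phi> e n m g) * norm g"
    using coercive norm_ip_le_cauchy_schwarz[of "W_op smul ip \<phi> e n m g" g] by (simp add: power2_eq_square mult.assoc)
  then show ?thesis using False by (simp only: mult_le_cancel_right) auto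
qed simp

context
  fixes e :: "nat \<Rightarrow> 'h" and n m :: nat and a :: real
  assumes a: "a > 0"
    and coercive: "\<And>g. g \<in> rec_space smul e n \<Longrightarrow> a * (norm g)\<^sup>2 \<le> (\<Sum>j=1..m. (norm (ip g (\<phi> j)))\<^sup>2)"
begin

lemma inj_on_W_op: "inj_on (W_op smul ip \<phi> e n m) (rec_space smul e n)"
proof (rule inj_onI)
  interpret W: Vector_Spaces.linear smul smul "W_op smul ip \<phi> e n m" by (rule linear_W_op)
  fix x y assume xy: "x \<in> rec_space smul e n" "y \<in> rec_space smul e n"
    and eq: "W_op smul ip \<phi> e n m x = W_op smul ip \<phi> e n m y"
  have "x - y \<in> rec_space smul e n" using xy unfolding rec_space_def by (rule span_diff)
  then have "a * norm (x - y) \<le> norm (W_op smul ip \<phi> e n m (x - y))"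
    using coercive by (intro W_op_lower)
  then have "a * norm (x - y) \<le> 0" using eq by (simp add: W.diff)
  then show "x = y" using a by (simp add: mult_le_0_iff)
qed

text \<open>The image of a basis is independent, has the same number of elements, and hence spans.\<close>
lemma bij_betw_W_op: "bij_betw (W_op smul ip \<phi> e n m) (rec_space smul e n) (rec_space smul e n)"
proof -
  let ?W = "W_op smul ip \<phi> e n m"
  let ?V = "rec_space smul e n"
  interpret W: Vector_Spaces.linear smul smul ?W by (rule linear_W_op)
  obtain B where B: "B \<subseteq> e ` {1..n}" "independent B" "e ` {1..n} \<subseteq> span B"
    by (rule maximal_independent_subset)
  have finB: "finite B" using B(1) finite_subset by blast
  have V: "?V = span B" unfolding rec_space_def
    using B span_mono[OF B(1)] span_minimal[OF B(3) subspace_span] by auto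
  have inj: "inj_on ?W (span B)" using inj_on_W_op V by simp
  have ind: "independent (?W ` B)" by (rule W.independent_injective_image[OF B(2) inj])
  have card: "card (?W ` B) = card B"
    using inj span_superset by (intro card_image inj_on_subset[OF inj])
  have sub: "?W ` B \<subseteq> span B" using W_op_in V by auto
  have "v \<in> span (?W ` B)" if v: "v \<in> span B" for v
  proof (rule ccontr)
    assume nv: "v \<notin> span (?W ` B)"
    then have "independent (insert v (?W ` B))" using ind by (rule independent_insertI)
    then have "card (insert v (?W ` B)) \<le> card B"
      using independent_span_bound[OF finB] sub v by blast
    moreover have "v \<notin> ?W ` B" using nv span_superset by blast
    ultimately show False using finB card by simp
  qed
  then have "span B \<subseteq> ?W ` span B" using W.span_image[of B] by blast
  then have "?W ` ?V = ?V" using V W_op_in by blast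
  then show ?thesis using inj_on_W_op by (simp add: bij_betw_def)
qed

lemma W_inv_in: "h \<in> rec_space smul e n \<Longrightarrow> W_inv smul ip \<phi> e n m h \<in> rec_space smul e n"
  and W_op_W_inv: "h \<in> rec_space smul e n \<Longrightarrow> W_op smul ip \<phi> e n m (W_inv smul ip \<phi> e n m h) = h"
  using bij_betw_W_op unfolding W_inv_def bij_betw_def
  by (auto intro: inv_into_into f_inv_into_f)

lemma op_norm_W_inv: "op_norm_on (rec_space smul e n) (W_inv smul ip \<phi> e n m) \<le> ereal (1 / a)"
  unfolding op_norm_on_def
proof (rule SUP_least)
  fix h assume h: "h \<in> rec_space smul e n"
  have "a * norm (W_inv smul ip \<phi> e n m h) \<le> norm h"
    using W_op_lower[OF W_inv_in[OF h] coercive[OF W_inv_in[OF h]]] W_op_W_inv[OF h] by simp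
  then have "norm (W_inv smul ip \<phi> e n m h) / norm h \<le> 1 / a"
    using a by (cases "h = 0") (simp_all add: field_simps)
  then show "ereal (norm (W_inv smul ip \<phi> e n m h) / norm h) \<le> ereal (1 / a)" by simp
qed

text \<open>Let Q be the projection and u the reconstruction, so that \<open>W u = Q S f\<close>.  As \<open>W (Q f) = Q S Q f\<close>,
the difference \<open>u - Q f\<close> is mapped by W to \<open>Q S (f - Q f)\<close>, and W is bounded below.\<close>
lemma reconstruction_error_le:
  "norm (f - reconstruction smul ip \<phi> e n m f)
    \<le> (1 + B / a) * norm (f - orth_proj ip (rec_space smul e n) f)"
proof -
  let ?W = "W_op smul ip \<phi> e n m"
  let ?V = "rec_space smul e n"
  let ?Q = "orth_proj ip ?V"
  let ?S = "partial_frame_op smul ip \<phi> m"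
  interpret W: Vector_Spaces.linear smul smul ?W by (rule linear_W_op)
  define u where "u = reconstruction smul ip \<phi> e n m f"
  have QV: "?Q x \<in> ?V" for x unfolding rec_space_def by (intro orth_proj_in) auto
  have uV: "u \<in> ?V"
    unfolding u_def reconstruction_def rec_space_def
    by (intro span_sum span_scale) (metis QV W_inv_in rec_space_def)
  have "?W u = (\<Sum>j=1..m. smul (ip f (\<phi> j)) (?Q (\<phi> j)))"
    by (simp add: u_def reconstruction_def W.sum W.scale W_op_W_inv[OF QV])
  also have "\<dots> = ?Q (?S f)"
  proof -
    have "?Q (\<Sum>j\<in>F. smul (ip f (\<phi> j)) (\<phi> j)) = (\<Sum>j\<in>F. smul (ip f (\<phi> j)) (?Q (\<phi> j)))" if "finite F" for F
      using that
    proof (induction F)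
      case empty
      show ?case unfolding rec_space_def by (simp add: orth_proj_id span_zero)
    next
      case (insert j F)
      then show ?case unfolding rec_space_def by (simp add: orth_proj_add orth_proj_scale)
    qed
    then show ?thesis by (simp add: partial_frame_op_def)
  qed
  finally have Wu: "?W u = ?Q (?S f)" .
  define h where "h = f - ?Q f"
  have "?W (u - ?Q f) = ?Q (?S h)"
  proof -
    have "?Q (?S f) = ?Q (?S h) + ?Q (?S (?Q f))"
      using partial_frame_op_add[of m h "?Q f"] unfolding rec_space_def
      by (simp add: h_def rec_space_def orth_proj_add[symmetric])
    then show ?thesis using Wu by (simp add: W.diff) (simp add: W_op_def)
  qed
  moreover have d: "u - ?Q f \<in> ?V" using uV QV unfolding rec_space_def by (intro span_diff)
  ultimately have "a * norm (u - ?Q f) \<le> norm (?Q (?S h))"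
    using W_op_lower[OF d coercive[OF d]] by simp
  also have "\<dots> \<le> norm (?S h)" unfolding rec_space_def by (intro norm_orth_proj_le) auto
  also have "\<dots> \<le> B * norm h" by (rule norm_partial_frame_op_le)
  finally have "norm (u - ?Q f) \<le> B / a * norm h" using a by (simp add: field_simps)
  moreover have "norm (f - u) \<le> norm h + norm (u - ?Q f)"
    using norm_triangle_ineq4[of h "u - ?Q f"] by (simp add: h_def)
  ultimately show ?thesis by (simp add: u_def h_def distrib_right)
qed

end

end

theorem theorem5p1:
  fixes smul :: "'k::hilbert_scalar \<Rightarrow> 'h::banach \<Rightarrow> 'h"
    and ip :: "'h \<Rightarrow> 'h \<Rightarrow> 'k"
    and \<psi> \<phi> :: "nat \<Rightarrow> 'h"
    and A B c1 s :: real
    and m :: "nat \<Rightarrow> nat"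
  assumes H: "separable_hilbert_space smul ip"
    and frame_psi: "is_frame ip \<psi> A B"
    and frame_phi: "\<exists>A' B'. is_frame ip \<phi> A' B'"
    and gram_inv: "\<And>n. n \<ge> 1 \<Longrightarrow> invertible_mat (gram_mat ip \<phi> n)"
    and c1: "c1 > 0" and s: "s > 1/2"
    and cross_decay: "\<And>j l. j \<ge> 1 \<Longrightarrow> l \<ge> 1 \<Longrightarrow>
          norm (ip (\<psi> j) (\<phi> l)) \<le> c1 * (1 + \<bar>real j - real l\<bar>) powr (- s)"
    and m_def: "\<And>n. n \<ge> 1 \<Longrightarrow> m n = n + nat \<lceil>(2 * c1\<^sup>2 * real n
          / (A * (2 * s - 1) * lambda_min (gram_mat ip \<phi> n))) powr (1 / (2 * s - 1))\<rceil>"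
  shows "(\<forall>n\<ge>1.
            bij_betw (W_op smul ip \<psi> \<phi> n (m n)) (rec_space smul \<phi> n) (rec_space smul \<phi> n) \<and>
            op_norm_on (rec_space smul \<phi> n) (W_inv smul ip \<psi> \<phi> n (m n)) \<le> ereal (2 / A)) \<and>
         (\<forall>c0 t c' f. c0 > 0 \<longrightarrow> t > 1 \<longrightarrow> t \<ge> s \<longrightarrow>
            (\<forall>j\<ge>1. \<forall>l\<ge>1. norm (ip (\<phi> j) (\<phi> l)) \<le> c0 * (1 + \<bar>real j - real l\<bar>) powr (- t)) \<longrightarrow>
            c' > 0 \<longrightarrow> (\<forall>j\<ge>1. norm (ip f (\<phi> j)) \<le> c' * real j powr (- t)) \<longrightarrow>
            (\<exists>c>0. \<forall>n\<ge>1. norm (f - reconstruction smul ip \<psi> \<phi> n (m n) f)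
                            \<le> c * real n powr (- (t - 1/2))))"
proof -
  interpret \<psi>: hilbert_frame smul ip \<psi> A B
    using H frame_psi by (simp add: hilbert_frame_def hilbert_frame_axioms_def)
  obtain A' B' where "is_frame ip \<phi> A' B'" using frame_phi by blast
  then interpret \<phi>: hilbert_frame smul ip \<phi> A' B'
    using H by (simp add: hilbert_frame_def hilbert_frame_axioms_def)
  have A2: "A / 2 > 0" using \<psi>.A_pos by simp
  have coercive: "A / 2 * (norm g)\<^sup>2 \<le> (\<Sum>j=1..m n. (norm (ip g (\<psi> j)))\<^sup>2)"
    if "n \<ge> 1" "g \<in> rec_space smul \<phi> n" for n g
    using that \<psi>.truncated_coercivity[OF that(1) gram_inv[OF that(1)] c1 s cross_decay m_def[OF that(1)]] by blast
  show ?thesis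
  proof (intro conjI allI impI)
    fix n :: nat assume n: "n \<ge> 1"
    show "bij_betw (W_op smul ip \<psi> \<phi> n (m n)) (rec_space smul \<phi> n) (rec_space smul \<phi> n)"
      by (rule \<psi>.bij_betw_W_op[OF A2 coercive[OF n]])
    show "op_norm_on (rec_space smul \<phi> n) (W_inv smul ip \<psi> \<phi> n (m n)) \<le> ereal (2 / A)"
      using \<psi>.op_norm_W_inv[OF A2 coercive[OF n]] by simp
  next
    fix c0 t c' :: real and f
    assume "c0 > 0" and t: "t > 1" and "t \<ge> s"
      and gram: "\<forall>j\<ge>1. \<forall>l\<ge>1. norm (ip (\<phi> j) (\<phi> l)) \<le> c0 * (1 + \<bar>real j - real l\<bar>) powr (- t)"
      and "c' > 0" and f: "\<forall>j\<ge>1. norm (ip f (\<phi> j)) \<le> c' * real j powr (- t)"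
    obtain C where C: "C \<ge> 0"
      and proj: "\<And>n. n \<ge> 1 \<Longrightarrow> norm (f - orth_proj ip (rec_space smul \<phi> n) f) \<le> C * real n powr (- (t - 1/2))"
      using \<phi>.projection_error_decay[OF t gram f] by blast
    define D where "D = 1 + B / (A / 2)"
    have D: "D > 0" using A2 \<psi>.B_pos by (simp add: D_def add_pos_pos)
    have "norm (f - reconstruction smul ip \<psi> \<phi> n (m n) f) \<le> (D * (C + 1)) * real n powr (- (t - 1/2))"
      if n: "n \<ge> 1" for n
    proof -
      have "norm (f - reconstruction smul ip \<psi> \<phi> n (m n) f)
          \<le> D * norm (f - orth_proj ip (rec_space smul \<phi> n) f)"
        unfolding D_def by (rule \<psi>.reconstruction_error_le[OF A2 coercive[OF n]])
      also have "\<dots> \<le> D * (C * real n powr (- (t - 1/2)))"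
        using D proj[OF n] by (intro mult_left_mono) auto
      also have "\<dots> \<le> D * ((C + 1) * real n powr (- (t - 1/2)))"
        using D by (intro mult_left_mono mult_right_mono) auto
      finally show ?thesis by (simp add: mult.assoc)
    qed
    then show "\<exists>c>0. \<forall>n\<ge>1. norm (f - reconstruction smul ip \<psi> \<phi> n (m n) f) \<le> c * real n powr (- (t - 1/2))"
      using C D by (intro exI[of _ "D * (C + 1)"]) auto
  qed
qed

end
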